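(* Let $k$ be a field, $n\geq 1$ and $A=k[x_1,\ldots,x_n]/\langle x_1\cdots x_n\rangle$. With respect to the $\mathbb{N}\times\mathbb{Z}^n$-grading by multidegree, the Hochschild cohomology $\mathrm{HH}^*(A)$ has Hilbert series $$\mathcal{H}(\mathrm{HH}^*(A);\mathbf{a})=\frac{(a_0+1)^{n+1}a_1\cdots a_n-(a_0+a_1)\cdots(a_0+a_n)\cdot(a_0+a_1\cdots a_n)}{(a_1\cdots a_n-a_0^2)\cdot(1-a_1)\cdots(1-a_n)}.$$
   Context: Put $A^e=A\otimes_k A$. Let $F_\bullet$ be the following free resolution of the $A^e$-module $A$ (with augmentation $\epsilon:F_0=A^e\to A$, $a\otimes b\mapsto ab$): $F_m$ is the free $A^e$-module with basis the symbols $e_It^{(q)}$, where $I\subseteq[n]=\{1,\ldots,n\}$, $q\geq0$, $|I|+2q=m$, and $e_I=e_{i_1}\wedge\cdots\wedge e_{i_s}$ for $I=\{i_1<\cdots<i_s\}$. The differential is $d(e_It^{(q)})=\sum_{j=1}^s(-1)^{j-1}(1\otimes x_{i_j}-x_{i_j}\otimes1)e_{I\smallsetminus\{i_j\}}t^{(q)}+\sum_{j=1}^n(x_1\cdots x_{j-1}\otimes x_{j+1}\cdots x_n)\,e_j\wedge e_I\,t^{(q-1)}$, the second sum being omitted if $q=0$. Then $\mathrm{HH}^*(A)$ is the cohomology of the complex $\mathrm{Hom}_{A^e}(F_\bullet,A)$. Let $\overline F_m$ be the $k$-vector space with the same basis as $F_m$; identify $\mathrm{Hom}_{A^e}(F_m,A)\cong\mathrm{Hom}_k(\overline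 F_m,A)$ and let $\partial$ be the resulting differential on $\mathrm{Hom}_k(\overline F_\bullet,A)$. A $k$-basis of $\mathrm{Hom}_k(\overline F_m,A)$ is given by the standard elements $(e_It^{(q)},\mathbf{x}^\alpha)$, where $|I|+2q=m$ and $\mathbf{x}^\alpha=x_1^{\alpha_1}\cdots x_n^{\alpha_n}$ is a monomial not divisible by $x_1\cdots x_n$; this is the map sending $e_It^{(q)}$ to $\mathbf{x}^\alpha$ and all other basis elements to $0$. The multidegree of a standard element is $$\mathrm{mdeg}(e_It^{(q)},\mathbf{x}^\alpha)=(|I|+2q,\ \alpha_1-\epsilon_1-q,\ \ldots,\ \alpha_n-\epsilon_n-q)\in\mathbb{N}\times\mathbb{Z}^n,$$ where $\epsilon_i=1$ if $i\in I$ and $\epsilon_i=0$ otherwise. The differential $\partial$ raises the first coordinate by $1$ and preserves the other $n$ coordinates, so the multidegree induces a grading $\mathrm{HH}^*(A)=\bigoplus_{\chi\in\mathbb{N}\times\mathbb{Z}^n}\mathbf{H}_\chi$ by $k$-vector spaces. The Hilbert series is $\mathcal{H}(\mathrm{HH}^*(A);\mathbf{a})=\sum_{\chi\in\mathbb{N}\times\mathbb{Z}^n}\dim_k(\mathbf{H}_\chi)\,\mathbf{a}^\chi$, with $\mathbf{a}^\chi=a_0^{\chi_0}a_1^{\chi_1}\cdots a_n^{\chi_n}$. The rational function is understood as a formal series in $\mathbb{Z}[[a_1,\ldots,a_n]][(a_1\cdots a_n)^{-1}][[a_0]]$, i.e. expanded via $\frac{1}{1-a_i}=\sum_{j\ge0}a_i^j$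 and $\frac{1}{a_1\cdots a_n-a_0^2}=(a_1\cdots a_n)^{-1}\sum_{q\geq0}\left(a_0^2(a_1\cdots a_n)^{-1}\right)^q$. *)

theory Defs
  imports
    "HOL-Library.Poly_Mapping"
    "HOL-Library.Function_Algebras"
    "HOL-Library.Cardinality"
    "HOL-Computational_Algebra.Formal_Power_Series"
begin

text \<open>
  The index set \<open>[n]\<close> is the finite linearly ordered type \<open>'n\<close>, so \<open>n = CARD('n) \<ge> 1\<close>.
  The field \<open>k\<close> is the type \<open>'k\<close>.
\<close>

text \<open>Without this, \<^typ>\<open>'n \<Rightarrow>\<^sub>0 nat\<close> would be unfolded to functions in the liftings below.\<close>

lifting_forget poly_mapping.lifting

section \<open>The algebra $A$\<close>

type_synonym ('n, 'k) mpoly = "('n \<Rightarrow>\<^sub>0 nat) \<Rightarrow>\<^sub>0 'k"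

definition mpoly_var :: "'n \<Rightarrow> ('n, 'k::field) mpoly" where
  "mpoly_var i = Poly_Mapping.single (Poly_Mapping.single i 1) 1"

lemma prod_mpoly_var:
  "(\<Prod>i\<in>UNIV. mpoly_var i :: ('n::finite, 'k::field) mpoly)
     = Poly_Mapping.single (\<Sum>i\<in>UNIV. Poly_Mapping.single i 1) 1"
proof -
  have "(\<Prod>i\<in>S. mpoly_var i :: ('n, 'k) mpoly)
     = Poly_Mapping.single (\<Sum>i\<in>S. Poly_Mapping.single i 1) 1" if "finite S" for S :: "'n set"
    using that by (induction S) (auto simp: mpoly_var_def mult_single)
  then show ?thesis by simp
qed

lemma not_prod_mpoly_var_dvd_1:
  "\<not> (\<Prod>i\<in>UNIV. mpoly_var i :: ('n::finite, 'k::field) mpoly) dvd 1"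
proof
  let ?u = "\<Sum>i\<in>UNIV. Poly_Mapping.single (i::'n) (1::nat)"
  assume "(\<Prod>i\<in>UNIV. mpoly_var i :: ('n, 'k) mpoly) dvd 1"
  then obtain r :: "('n, 'k) mpoly" where r: "1 = Poly_Mapping.single ?u 1 * r"
    unfolding prod_mpoly_var by (elim dvdE)
  have "0 \<notin> Poly_Mapping.keys (Poly_Mapping.single ?u 1 * r)"
  proof
    assume "0 \<in> Poly_Mapping.keys (Poly_Mapping.single ?u 1 * r)"
    then obtain b where "0 = ?u + b"
      using keys_mult[of "Poly_Mapping.single ?u 1" r] by (auto split: if_splits)
    then have "Poly_Mapping.lookup (0 :: 'n \<Rightarrow>\<^sub>0 nat) i = Poly_Mapping.lookup (?u + b) i" for i
      by simp
    then have "Poly_Mapping.lookup ?u i = 0" for i :: 'n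
      by (simp add: lookup_add)
    then show False
      by (simp add: lookup_sum lookup_single when_def)
  qed
  then show False
    unfolding r[symmetric] by simp
qed

quotient_type (overloaded) ('n, 'k) coord_ring = "('n::finite, 'k::field) mpoly" /
  "\<lambda>p q. (\<Prod>i\<in>UNIV. mpoly_var i) dvd p - q"
proof (rule equivpI)
  show "reflp (\<lambda>p q :: ('n, 'k) mpoly. (\<Prod>i\<in>UNIV. mpoly_var i) dvd p - q)"
    by (simp add: reflp_def)
  show "symp (\<lambda>p q :: ('n, 'k) mpoly. (\<Prod>i\<in>UNIV. mpoly_var i) dvd p - q)"
    by (rule sympI) (subst minus_diff_eq[symmetric], subst dvd_minus_iff, assumption)
  show "transp (\<lambda>p q :: ('n, 'k) mpoly. (\<Prod>i\<in>UNIV. mpoly_var i) dvd p - q)"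
    by (rule transpI) (drule (1) dvd_add, simp)
qed

lemma diff_diff_diff: "a - b - (c - d) = a - c - (b - d :: 'a::ab_group_add)"
  by (simp add: algebra_simps)

lemma dvd_mult_diff:
  fixes m a b c d :: "'a::comm_ring_1"
  assumes "m dvd a - b" "m dvd c - d"
  shows "m dvd a * c - b * d"
proof -
  have "a * c - b * d = (a - b) * c + b * (c - d)" by (simp add: algebra_simps)
  then show ?thesis using assms by simp
qed

instantiation coord_ring :: (finite, field) comm_ring_1
begin

lift_definition zero_coord_ring :: "('a, 'b) coord_ring" is 0 .
lift_definition one_coord_ring :: "('a, 'b) coord_ring" is 1 .
lift_definition plus_coord_ring ::
  "('a, 'b) coord_ring \<Rightarrow> ('a, 'b) coord_ring \<Rightarrow> ('a, 'b) coord_ring" is "(+)"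
  by (simp only: add_diff_add dvd_add)
lift_definition minus_coord_ring ::
  "('a, 'b) coord_ring \<Rightarrow> ('a, 'b) coord_ring \<Rightarrow> ('a, 'b) coord_ring" is "(-)"
  by (simp only: diff_diff_diff dvd_diff)
lift_definition uminus_coord_ring :: "('a, 'b) coord_ring \<Rightarrow> ('a, 'b) coord_ring" is uminus
  by (simp only: minus_diff_minus dvd_minus_iff)
lift_definition times_coord_ring ::
  "('a, 'b) coord_ring \<Rightarrow> ('a, 'b) coord_ring \<Rightarrow> ('a, 'b) coord_ring" is "(*)"
  by (rule dvd_mult_diff)

instance
proof
  show "(0 :: ('a, 'b) coord_ring) \<noteq> 1"
    by transfer (use not_prod_mpoly_var_dvd_1 dvd_minus_iff in fastforce)
qed (transfer; simp add: algebra_simps)+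

end

lift_definition coord_scale :: "'k \<Rightarrow> ('n::finite, 'k::field) coord_ring \<Rightarrow> ('n, 'k) coord_ring"
  is "\<lambda>c p. Poly_Mapping.single 0 c * p"
  by (simp only: dvd_mult flip: right_diff_distrib)

lift_definition coord_monom :: "('n \<Rightarrow>\<^sub>0 nat) \<Rightarrow> ('n::finite, 'k::field) coord_ring"
  is "\<lambda>\<alpha>. Poly_Mapping.single \<alpha> 1" .

definition coord_var :: "'n \<Rightarrow> ('n::finite, 'k::field) coord_ring" where
  "coord_var i = coord_monom (Poly_Mapping.single i 1)"

interpretation coord_vs: vector_space "coord_scale :: 'k::field \<Rightarrow> ('n::finite, 'k) coord_ring \<Rightarrow> _"
proof
  fix a b :: 'k and x y :: "('n, 'k) coord_ring"
  show "coord_scale a (x + y) = coord_scale a x + coord_scale a y"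
    by transfer (simp add: algebra_simps)
  show "coord_scale (a + b) x = coord_scale a x + coord_scale b x"
    by transfer (simp add: algebra_simps single_add)
  show "coord_scale a (coord_scale b x) = coord_scale (a * b) x"
    by transfer (simp add: mult_single flip: mult.assoc)
  show "coord_scale 1 x = x"
    by transfer simp
qed

lemma coord_scale_mult_left: "coord_scale c x * y = coord_scale c (x * y)"
  by transfer (simp add: mult.assoc)

lemma coord_scale_mult_right: "x * coord_scale c y = coord_scale c (x * y)"
  by transfer (simp add: algebra_simps)


lifting_forget coord_ring.lifting


section \<open>The enveloping algebra $A \otimes_k A$\<close>

text \<open>
  The additively written monoid of pairs \<open>(a, b)\<close> with componentwise multiplication. Its monoid
  algebra over \<open>k\<close> is the free \<open>k\<close>-module on \<open>A \<times> A\<close>, with \<open>(a, b) (a', b') = (a a', b b')\<close>;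
  the tensor product is its quotient by the bilinearity relations. The ideal generated by these
  relations is equal to their \<open>k\<close>-span, the set of relations being stable up to scalars under
  multiplication by pairs.
\<close>

datatype 'a tpair = TPair 'a 'a

instantiation tpair :: (comm_monoid_mult) comm_monoid_add
begin

definition zero_tpair :: "'a tpair" where "0 = TPair 1 1"

fun plus_tpair :: "'a tpair \<Rightarrow> 'a tpair \<Rightarrow> 'a tpair" where
  "TPair a b + TPair a' b' = TPair (a * a') (b * b')"

instance
proof
  fix x y z :: "'a tpair"
  show "x + y + z = x + (y + z)" by (cases x; cases y; cases z) (simp add: mult.assoc)
  show "x + y = y + x" by (cases x; cases y) (simp add: mult.commute)
  show "0 + x = x" by (cases x) (simp add: zero_tpair_def)
qed

end

definition tensor_relations :: "(('n::finite, 'k::field) coord_ring tpair \<Rightarrow>\<^sub>0 'k) set" where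
  "tensor_relations =
     {Poly_Mapping.single (TPair (a + a') b) 1
        - Poly_Mapping.single (TPair a b) 1 - Poly_Mapping.single (TPair a' b) 1 | a a' b. True}
   \<union> {Poly_Mapping.single (TPair a (b + b')) 1
        - Poly_Mapping.single (TPair a b) 1 - Poly_Mapping.single (TPair a b') 1 | a b b'. True}
   \<union> {Poly_Mapping.single (TPair (coord_scale c a) b) 1 - Poly_Mapping.single (TPair a b) c | a b c. True}
   \<union> {Poly_Mapping.single (TPair a (coord_scale c b)) 1 - Poly_Mapping.single (TPair a b) c | a b c. True}"

lemma ring_module: "module ((*) :: 'a::comm_ring_1 \<Rightarrow> 'a \<Rightarrow> 'a)"
  by standard (simp_all add: algebra_simps)

lemmas ideal_zero = module.span_zero[OF ring_module]
lemmas ideal_add = module.span_add[OF ring_module]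
lemmas ideal_diff = module.span_diff[OF ring_module]
lemmas ideal_neg = module.span_neg[OF ring_module]
lemmas ideal_scale = module.span_scale[OF ring_module]

abbreviation tensor_ideal :: "(('n::finite, 'k::field) coord_ring tpair \<Rightarrow>\<^sub>0 'k) set" where
  "tensor_ideal \<equiv> module.span (*) tensor_relations"

fun tpair_mult :: "'a::times tpair \<Rightarrow> 'a" where
  "tpair_mult (TPair a b) = a * b"

definition tensor_mult ::
  "(('n::finite, 'k::field) coord_ring tpair \<Rightarrow>\<^sub>0 'k) \<Rightarrow> ('n, 'k) coord_ring" where
  "tensor_mult p = (\<Sum>t\<in>Poly_Mapping.keys p. coord_scale (Poly_Mapping.lookup p t) (tpair_mult t))"

lemma tpair_mult_plus: "tpair_mult (s + t) = tpair_mult s * (tpair_mult t :: 'a::comm_monoid_mult)"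
  by (cases s; cases t) (simp add: ac_simps)

lemma tensor_mult_add: "tensor_mult (p + q) = tensor_mult p + tensor_mult q"
  unfolding tensor_mult_def
  by (rule setsum_keys_plus_distrib) (simp_all add: coord_vs.scale_left_distrib)

lemma tensor_mult_single [simp]:
  "tensor_mult (Poly_Mapping.single t c) = coord_scale c (tpair_mult t)"
  by (simp add: tensor_mult_def)

lemma tensor_mult_0 [simp]: "tensor_mult 0 = 0"
  by (simp add: tensor_mult_def)

lemma tensor_mult_diff: "tensor_mult (p - q) = tensor_mult p - tensor_mult q"
  by (metis tensor_mult_add add_diff_cancel diff_add_cancel)

lemma tensor_mult_1: "tensor_mult 1 = 1"
  by (simp add: zero_tpair_def flip: single_one)

lemma poly_mapping_add_induct [case_names zero single add]:
  assumes "P 0" "\<And>k c. P (Poly_Mapping.single k c)" "\<And>p q. P p \<Longrightarrow> P q \<Longrightarrow> P (p + q)"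
  shows "P (p :: 'a \<Rightarrow>\<^sub>0 'b::comm_monoid_add)"
proof -
  have "P (\<Sum>k\<in>S. Poly_Mapping.single k (Poly_Mapping.lookup p k))" if "finite S" for S
    using that by (induction S) (auto intro: assms)
  moreover have "p = (\<Sum>k\<in>Poly_Mapping.keys p. Poly_Mapping.single k (Poly_Mapping.lookup p k))"
    by (rule poly_mapping_eqI)
       (auto simp: lookup_sum lookup_single when_def in_keys_iff)
  ultimately show ?thesis by (metis finite_keys)
qed

lemma tensor_mult_mult: "tensor_mult (p * q) = tensor_mult p * tensor_mult q"
proof (induction p rule: poly_mapping_add_induct)
  case (single s c)
  show ?case
    by (induction q rule: poly_mapping_add_induct)
       (simp_all add: mult_single tpair_mult_plus coord_scale_mult_left coord_scale_mult_right
          tensor_mult_add algebra_simps)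
qed (simp_all add: tensor_mult_add algebra_simps)

lemma tensor_mult_relations: "p \<in> tensor_relations \<Longrightarrow> tensor_mult p = 0"
  by (auto simp: tensor_relations_def tensor_mult_diff coord_vs.scale_right_distrib
      coord_scale_mult_left coord_scale_mult_right distrib_left distrib_right)

lemma tensor_mult_ideal: "p \<in> tensor_ideal \<Longrightarrow> tensor_mult p = 0"
proof (induction rule: module.span_induct_alt[OF ring_module, consumes 1, case_names base step])
  case (step c x y)
  have "tensor_mult x = 0" using step(1) by (rule tensor_mult_relations)
  then show ?case using step by (simp add: tensor_mult_add tensor_mult_mult)
qed simp

quotient_type (overloaded) ('n, 'k) env_alg = "('n::finite, 'k::field) coord_ring tpair \<Rightarrow>\<^sub>0 'k" /
  "\<lambda>p q. p - q \<in> tensor_ideal"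
proof (rule equivpI)
  show "reflp (\<lambda>p q :: ('n, 'k) coord_ring tpair \<Rightarrow>\<^sub>0 'k. p - q \<in> tensor_ideal)"
    by (simp add: reflp_def ideal_zero)
  show "symp (\<lambda>p q :: ('n, 'k) coord_ring tpair \<Rightarrow>\<^sub>0 'k. p - q \<in> tensor_ideal)"
    by (rule sympI) (drule ideal_neg, simp)
  show "transp (\<lambda>p q :: ('n, 'k) coord_ring tpair \<Rightarrow>\<^sub>0 'k. p - q \<in> tensor_ideal)"
    by (rule transpI) (drule (1) ideal_add, simp)
qed

lemma span_mult_diff:
  fixes a b c d :: "'a::comm_ring_1"
  assumes "a - b \<in> module.span (*) S" "c - d \<in> module.span (*) S"
  shows "a * c - b * d \<in> module.span (*) S"
proof -
  have "a * c - b * d = c * (a - b) + b * (c - d)" by (simp add: algebra_simps)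
  then show ?thesis using assms by (simp only: ideal_add ideal_scale)
qed

instantiation env_alg :: (finite, field) comm_ring_1
begin

lift_definition zero_env_alg :: "('a, 'b) env_alg" is 0 .
lift_definition one_env_alg :: "('a, 'b) env_alg" is 1 .
lift_definition plus_env_alg ::
  "('a, 'b) env_alg \<Rightarrow> ('a, 'b) env_alg \<Rightarrow> ('a, 'b) env_alg" is "(+)"
  by (simp only: add_diff_add ideal_add)
lift_definition minus_env_alg ::
  "('a, 'b) env_alg \<Rightarrow> ('a, 'b) env_alg \<Rightarrow> ('a, 'b) env_alg" is "(-)"
  by (simp only: diff_diff_diff ideal_diff)
lift_definition uminus_env_alg :: "('a, 'b) env_alg \<Rightarrow> ('a, 'b) env_alg" is uminus
  by (simp only: minus_diff_minus ideal_neg)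
lift_definition times_env_alg ::
  "('a, 'b) env_alg \<Rightarrow> ('a, 'b) env_alg \<Rightarrow> ('a, 'b) env_alg" is "(*)"
  by (rule span_mult_diff)

instance
proof
  show "(0 :: ('a, 'b) env_alg) \<noteq> 1"
  proof transfer
    have "tensor_mult (0 - 1 :: ('a, 'b) coord_ring tpair \<Rightarrow>\<^sub>0 'b) = - 1"
      using tensor_mult_diff[of 0 1] by (simp add: tensor_mult_1)
    then show "(0 :: ('a, 'b) coord_ring tpair \<Rightarrow>\<^sub>0 'b) - 1 \<notin> tensor_ideal"
      using tensor_mult_ideal by fastforce
  qed
qed (transfer; simp add: algebra_simps ideal_zero)+

end

lift_definition tensor :: "('n::finite, 'k::field) coord_ring \<Rightarrow> ('n, 'k) coord_ring \<Rightarrow> ('n, 'k) env_alg"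
    (infixl "\<otimes>\<^sub>k" 72)
  is "\<lambda>a b. Poly_Mapping.single (TPair a b) 1" .

lift_definition augmentation :: "('n::finite, 'k::field) env_alg \<Rightarrow> ('n, 'k) coord_ring"
  is tensor_mult
  using tensor_mult_ideal by (fastforce simp: tensor_mult_diff)

lemma augmentation_tensor: "augmentation (a \<otimes>\<^sub>k b) = a * b"
  by transfer simp

lemma augmentation_add: "augmentation (s + t) = augmentation s + augmentation t"
  by transfer (simp add: tensor_mult_add)

lemma augmentation_mult: "augmentation (s * t) = augmentation s * augmentation t"
  by transfer (simp add: tensor_mult_mult)

lemma augmentation_1: "augmentation 1 = 1"
  by transfer (rule tensor_mult_1)

text \<open>The action \<open>(a \<otimes> b) c = a c b\<close> of the enveloping algebra on \<open>A\<close>.\<close>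

definition env_act :: "('n::finite, 'k::field) env_alg \<Rightarrow> ('n, 'k) coord_ring \<Rightarrow> ('n, 'k) coord_ring" where
  "env_act s c = augmentation s * c"

lemma env_act_tensor: "env_act (a \<otimes>\<^sub>k b) c = a * c * b"
  by (simp add: env_act_def augmentation_tensor ac_simps)


lifting_forget env_alg.lifting


section \<open>The resolution\<close>

text \<open>
  The symbol \<open>e\<^sub>I t\<^sup>(\<^sup>q\<^sup>)\<close> is the pair \<open>(I, q)\<close>. The type below is the direct sum of all \<open>F\<^sub>m\<close>;
  \<open>F\<^sub>m\<close> is spanned by the symbols of degree \<open>m\<close>.
\<close>

type_synonym 'n symb = "'n set \<times> nat"

type_synonym ('n, 'k) resolution = "'n symb \<Rightarrow>\<^sub>0 ('n, 'k) env_alg"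

definition symb_degree :: "'n symb \<Rightarrow> nat" where
  "symb_degree b = card (fst b) + 2 * snd b"

definition res_scale ::
  "('n::finite, 'k::field) env_alg \<Rightarrow> ('n, 'k) resolution \<Rightarrow> ('n, 'k) resolution" where
  "res_scale s z = Poly_Mapping.map ((*) s) z"

definition res_basis :: "'n symb \<Rightarrow> ('n::finite, 'k::field) resolution" where
  "res_basis b = Poly_Mapping.single b 1"

text \<open>\<open>e\<^sub>j \<and> e\<^sub>I t\<^sup>(\<^sup>q\<^sup>)\<close>, rewritten in terms of the basis.\<close>

definition wedge :: "'n::{finite,linorder} \<Rightarrow> 'n set \<Rightarrow> nat \<Rightarrow> ('n, 'k::field) resolution" where
  "wedge j I q =
     (if j \<in> I then 0 else res_scale ((-1) ^ card {i\<in>I. i < j}) (res_basis (insert j I, q)))"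

definition res_diff_basis :: "'n::{finite,linorder} symb \<Rightarrow> ('n, 'k::field) resolution" where
  "res_diff_basis = (\<lambda>(I, q).
     (\<Sum>i\<in>I. res_scale ((-1) ^ card {i'\<in>I. i' < i} * (1 \<otimes>\<^sub>k coord_var i - coord_var i \<otimes>\<^sub>k 1))
                (res_basis (I - {i}, q)))
     + (if q = 0 then 0 else
          (\<Sum>j\<in>UNIV. res_scale ((\<Prod>i\<in>{..<j}. coord_var i) \<otimes>\<^sub>k (\<Prod>i\<in>{j<..}. coord_var i))
                (wedge j I (q - 1)))))"

definition res_diff :: "('n::{finite,linorder}, 'k::field) resolution \<Rightarrow> ('n, 'k) resolution" where
  "res_diff z = (\<Sum>b\<in>Poly_Mapping.keys z. res_scale (Poly_Mapping.lookup z b) (res_diff_basis b))"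


section \<open>Hochschild cohomology\<close>

text \<open>
  A linear map on the direct sum of the \<open>F\<^sub>m\<close> is a family of linear maps on the \<open>F\<^sub>m\<close>; the
  boundedness condition says that all but finitely many of them vanish. So this is the direct sum
  of the modules of homomorphisms \<open>F\<^sub>m \<rightarrow> A\<close>.
\<close>

definition cochains :: "(('n::finite, 'k::field) resolution \<Rightarrow> ('n, 'k) coord_ring) set" where
  "cochains = {f. module_hom res_scale env_act f \<and>
                  (\<exists>M. \<forall>b. M < symb_degree b \<longrightarrow> f (res_basis b) = 0)}"

definition coboundary ::
  "(('n::{finite,linorder}, 'k::field) resolution \<Rightarrow> ('n, 'k) coord_ring) \<Rightarrow>
   (('n, 'k) resolution \<Rightarrow> ('n, 'k) coord_ring)" where
  "coboundary f = f \<circ> res_diff"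

definition cocycles ::
  "(('n::{finite,linorder}, 'k::field) resolution \<Rightarrow> ('n, 'k) coord_ring) set" where
  "cocycles = {f \<in> cochains. coboundary f = 0}"

definition coboundaries ::
  "(('n::{finite,linorder}, 'k::field) resolution \<Rightarrow> ('n, 'k) coord_ring) set" where
  "coboundaries = coboundary ` cochains"

definition cochain_scale ::
  "'k \<Rightarrow> (('n::finite, 'k::field) resolution \<Rightarrow> ('n, 'k) coord_ring) \<Rightarrow>
   (('n, 'k) resolution \<Rightarrow> ('n, 'k) coord_ring)" where
  "cochain_scale c f = (\<lambda>z. coord_scale c (f z))"

interpretation cochain_vs: vector_space
  "cochain_scale :: 'k::field \<Rightarrow> (('n::finite, 'k) resolution \<Rightarrow> _) \<Rightarrow> _"
  by standard
     (simp_all add: cochain_scale_def fun_eq_iff coord_vs.scale_left_distrib coord_vs.scale_right_distrib)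

lemma lookup_res_scale [simp]:
  "Poly_Mapping.lookup (res_scale s z) b = s * Poly_Mapping.lookup z b"
  by (auto simp: res_scale_def Poly_Mapping.map.rep_eq when_def)

interpretation res_module: module
  "res_scale :: ('n::finite, 'k::field) env_alg \<Rightarrow> ('n, 'k) resolution \<Rightarrow> _"
  by standard (auto intro!: poly_mapping_eqI simp: lookup_add algebra_simps)

interpretation env_module: module
  "env_act :: ('n::finite, 'k::field) env_alg \<Rightarrow> ('n, 'k) coord_ring \<Rightarrow> _"
  by standard (simp_all add: env_act_def augmentation_add augmentation_mult augmentation_1 algebra_simps)

lemma res_env_pair: "module_pair res_scale env_act"
  by (simp add: module_pair_def res_module.module_axioms env_module.module_axioms)

lemma env_act_coord_scale: "env_act s (coord_scale c x) = coord_scale c (env_act s x)"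
  by (simp add: env_act_def coord_scale_mult_right)

lemma subspace_cochains:
  "cochain_vs.subspace (cochains :: (('n::finite, 'k::field) resolution \<Rightarrow> ('n, 'k) coord_ring) set)"
proof (rule cochain_vs.subspaceI)
  show "0 \<in> (cochains :: (('n, 'k) resolution \<Rightarrow> ('n, 'k) coord_ring) set)"
    using module_pair.module_hom_zero[OF res_env_pair] by (simp add: cochains_def zero_fun_def)
next
  fix f g :: "('n, 'k) resolution \<Rightarrow> ('n, 'k) coord_ring"
  assume *: "f \<in> cochains" "g \<in> cochains"
  then obtain M N where "\<forall>b. M < symb_degree b \<longrightarrow> f (res_basis b) = 0"
    "\<forall>b. N < symb_degree b \<longrightarrow> g (res_basis b) = 0"
    by (auto simp: cochains_def)
  then have "\<forall>b. max M N < symb_degree b \<longrightarrow> (f + g) (res_basis b) = 0"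
    by simp
  moreover have "module_hom res_scale env_act (f + g)"
    using * by (auto simp: cochains_def plus_fun_def intro!: module_pair.module_hom_add[OF res_env_pair])
  ultimately show "f + g \<in> cochains" unfolding cochains_def by blast
next
  fix c and f :: "('n, 'k) resolution \<Rightarrow> ('n, 'k) coord_ring"
  assume "f \<in> cochains"
  then show "cochain_scale c f \<in> cochains"
    unfolding cochains_def cochain_scale_def
    by (auto simp: module_hom_iff env_act_coord_scale coord_vs.scale_right_distrib) blast
qed

lemma coboundary_add: "coboundary (f + g) = coboundary f + coboundary g"
  by (simp add: coboundary_def fun_eq_iff)

lemma coboundary_scale: "coboundary (cochain_scale c f) = cochain_scale c (coboundary f)"
  by (simp add: coboundary_def cochain_scale_def fun_eq_iff)

lemma coboundary_0 [simp]: "coboundary 0 = 0"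
  by (simp add: coboundary_def fun_eq_iff)

lemma subspace_cocycles: "cochain_vs.subspace cocycles"
  using subspace_cochains
  by (auto simp: cocycles_def cochain_vs.subspace_def coboundary_add coboundary_scale)

lemma subspace_coboundaries: "cochain_vs.subspace coboundaries"
  using subspace_cochains
  unfolding coboundaries_def cochain_vs.subspace_def
  by (auto simp flip: coboundary_add coboundary_scale intro: image_eqI[where x = 0])

quotient_type (overloaded) ('n, 'k) HH =
  "('n::{finite,linorder}, 'k::field) resolution \<Rightarrow> ('n, 'k) coord_ring" /
  partial: "\<lambda>f g. f \<in> cocycles \<and> g \<in> cocycles \<and> f - g \<in> coboundaries"
proof (rule part_equivpI)
  let ?R = "\<lambda>f g :: ('n, 'k) resolution \<Rightarrow> ('n, 'k) coord_ring.
    f \<in> cocycles \<and> g \<in> cocycles \<and> f - g \<in> coboundaries"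
  show "\<exists>f. ?R f f"
    using cochain_vs.subspace_0[OF subspace_cocycles] cochain_vs.subspace_0[OF subspace_coboundaries]
    by (intro exI[of _ 0]) auto
  show "symp ?R"
    by (rule sympI) (auto dest: cochain_vs.subspace_neg[OF subspace_coboundaries])
  show "transp ?R"
    by (rule transpI) (auto dest: cochain_vs.subspace_add[OF subspace_coboundaries, of "x - y" "y - z" for x y z])
qed

instantiation HH :: ("{finite,linorder}", field) ab_group_add
begin

lift_definition zero_HH :: "('a, 'b) HH" is 0
  using cochain_vs.subspace_0[OF subspace_cocycles] cochain_vs.subspace_0[OF subspace_coboundaries]
  by auto
lift_definition plus_HH :: "('a, 'b) HH \<Rightarrow> ('a, 'b) HH \<Rightarrow> ('a, 'b) HH" is "(+)"
  by (simp only: add_diff_add cochain_vs.subspace_add subspace_cocycles subspace_coboundaries simp_thms)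
lift_definition minus_HH :: "('a, 'b) HH \<Rightarrow> ('a, 'b) HH \<Rightarrow> ('a, 'b) HH" is "(-)"
  by (simp only: diff_diff_diff cochain_vs.subspace_diff subspace_cocycles subspace_coboundaries simp_thms)
lift_definition uminus_HH :: "('a, 'b) HH \<Rightarrow> ('a, 'b) HH" is uminus
  by (simp only: minus_diff_minus cochain_vs.subspace_neg subspace_cocycles subspace_coboundaries simp_thms)

instance
  by (standard; transfer)
     (auto simp: algebra_simps intro!: cochain_vs.subspace_add[OF subspace_cocycles]
        cochain_vs.subspace_0[OF subspace_coboundaries] cochain_vs.subspace_0[OF subspace_cocycles]
        cochain_vs.subspace_diff[OF subspace_cocycles] cochain_vs.subspace_neg[OF subspace_cocycles])

end

lift_definition HH_scale :: "'k \<Rightarrow> ('n::{finite,linorder}, 'k::field) HH \<Rightarrow> ('n, 'k) HH"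
  is cochain_scale
  by (simp only: cochain_vs.subspace_scale subspace_cocycles subspace_coboundaries simp_thms
      flip: cochain_vs.scale_right_diff_distrib)

interpretation HH_vs: vector_space "HH_scale :: 'k::field \<Rightarrow> ('n::{finite,linorder}, 'k) HH \<Rightarrow> _"
proof
  have *: "cochain_vs.subspace cocycles" "0 \<in> coboundaries"
    by (rule subspace_cocycles cochain_vs.subspace_0[OF subspace_coboundaries])+
  note sub = cochain_vs.subspace_add[OF *(1)] cochain_vs.subspace_scale[OF *(1)]
  fix a b :: 'k and x y :: "('n, 'k) HH"
  show "HH_scale a (x + y) = HH_scale a x + HH_scale a y"
    by transfer (simp add: * sub cochain_vs.scale_right_distrib)
  show "HH_scale (a + b) x = HH_scale a x + HH_scale b x"
    by transfer (simp add: * sub cochain_vs.scale_left_distrib)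
  show "HH_scale a (HH_scale b x) = HH_scale (a * b) x"
    by transfer (simp add: * sub)
  show "HH_scale 1 x = x"
    by transfer (simp add: * sub)
qed


section \<open>The multidegree\<close>

definition std_cochain ::
  "'n symb \<Rightarrow> ('n \<Rightarrow>\<^sub>0 nat) \<Rightarrow> ('n::finite, 'k::field) resolution \<Rightarrow> ('n, 'k) coord_ring" where
  "std_cochain b \<alpha> = (\<lambda>z. env_act (Poly_Mapping.lookup z b) (coord_monom \<alpha>))"

lemma std_cochain_basis:
  "std_cochain b \<alpha> (res_basis b') = (if b' = b then coord_monom \<alpha> else 0)"
  by (simp add: std_cochain_def res_basis_def lookup_single when_def)

lemma std_cochain_cochains: "std_cochain b \<alpha> \<in> cochains"
proof -
  have "module_hom res_scale env_act (std_cochain b \<alpha>)"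
    by (simp add: module_hom_iff res_module.module_axioms env_module.module_axioms
        std_cochain_def lookup_add env_module.scale_left_distrib)
  moreover have "\<forall>b'. symb_degree b < symb_degree b' \<longrightarrow> std_cochain b \<alpha> (res_basis b') = 0"
    by (auto simp: std_cochain_basis)
  ultimately show ?thesis unfolding cochains_def by blast
qed

definition mdeg :: "'n symb \<Rightarrow> ('n \<Rightarrow>\<^sub>0 nat) \<Rightarrow> nat \<times> ('n \<Rightarrow> int)" where
  "mdeg = (\<lambda>(I, q) \<alpha>.
     (card I + 2 * q, \<lambda>i. int (Poly_Mapping.lookup \<alpha> i) - (if i \<in> I then 1 else 0) - int q))"

text \<open>A monomial is not divisible by \<open>x\<^sub>1 \<cdots> x\<^sub>n\<close> iff one of its exponents is \<open>0\<close>.\<close>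

definition graded_cochains ::
  "nat \<times> ('n \<Rightarrow> int) \<Rightarrow> (('n::finite, 'k::field) resolution \<Rightarrow> ('n, 'k) coord_ring) set" where
  "graded_cochains \<chi> =
     cochain_vs.span {std_cochain b \<alpha> | b \<alpha>. (\<exists>i. Poly_Mapping.lookup \<alpha> i = 0) \<and> mdeg b \<alpha> = \<chi>}"

definition HH_component :: "nat \<times> ('n \<Rightarrow> int) \<Rightarrow> ('n::{finite,linorder}, 'k::field) HH set" where
  "HH_component \<chi> = abs_HH ` (cocycles \<inter> graded_cochains \<chi>)"

lemma abs_HH_add:
  assumes "f \<in> cocycles" "g \<in> cocycles"
  shows "abs_HH (f + g) = abs_HH f + abs_HH g"
  by (rule plus_HH.abs_eq[symmetric]) (simp_all add: assms cochain_vs.subspace_0[OF subspace_coboundaries])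

lemma abs_HH_scale:
  assumes "f \<in> cocycles"
  shows "abs_HH (cochain_scale c f) = HH_scale c (abs_HH f)"
  by (rule HH_scale.abs_eq[symmetric]) (simp add: assms cochain_vs.subspace_0[OF subspace_coboundaries])

lemma subspace_HH_component:
  "HH_vs.subspace (HH_component \<chi> :: ('n::{finite,linorder}, 'k::field) HH set)"
proof -
  have sub: "cochain_vs.subspace
      (cocycles \<inter> graded_cochains \<chi> :: (('n, 'k) resolution \<Rightarrow> ('n, 'k) coord_ring) set)"
    unfolding graded_cochains_def
    by (intro cochain_vs.subspace_inter subspace_cocycles cochain_vs.subspace_span)
  show ?thesis
  proof (rule HH_vs.subspaceI)
    show "0 \<in> (HH_component \<chi> :: ('n, 'k) HH set)"
      unfolding HH_component_def zero_HH.abs_eq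
      using cochain_vs.subspace_0[OF sub] by (rule imageI)
  next
    fix x y :: "('n, 'k) HH" assume "x \<in> HH_component \<chi>" "y \<in> HH_component \<chi>"
    then show "x + y \<in> HH_component \<chi>"
      unfolding HH_component_def
      using cochain_vs.subspace_add[OF sub] by (auto simp flip: abs_HH_add)
  next
    fix c and x :: "('n, 'k) HH" assume "x \<in> HH_component \<chi>"
    then show "HH_scale c x \<in> HH_component \<chi>"
      unfolding HH_component_def
      using cochain_vs.subspace_scale[OF sub] by (auto simp flip: abs_HH_scale)
  qed
qed

lemma finite_mdeg_fibre:
  "finite {(b :: 'n::finite symb, \<alpha>). mdeg b \<alpha> = \<chi>}"
proof -
  have "inj_on fst {(b :: 'n symb, \<alpha>). mdeg b \<alpha> = \<chi>}"
  proof (rule inj_onI)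
    fix x y :: "'n symb \<times> ('n \<Rightarrow>\<^sub>0 nat)"
    assume x: "x \<in> {(b, \<alpha>). mdeg b \<alpha> = \<chi>}" and y: "y \<in> {(b, \<alpha>). mdeg b \<alpha> = \<chi>}" and "fst x = fst y"
    then obtain I q \<alpha> \<beta> where xy: "x = ((I, q), \<alpha>)" "y = ((I, q), \<beta>)"
      by (metis prod.collapse)
    have "snd (mdeg (I, q) \<alpha>) i = snd (mdeg (I, q) \<beta>) i" for i
      using x y xy by simp
    then have "Poly_Mapping.lookup \<alpha> i = Poly_Mapping.lookup \<beta> i" for i
      by (simp add: mdeg_def)
    then show "x = y" using xy by (simp add: poly_mapping_eqI)
  qed
  moreover have "fst ` {(b :: 'n symb, \<alpha>). mdeg b \<alpha> = \<chi>} \<subseteq> UNIV \<times> {..fst \<chi>}"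
    by (auto simp: mdeg_def)
  then have "finite (fst ` {(b :: 'n symb, \<alpha>). mdeg b \<alpha> = \<chi>})"
    by (rule finite_subset) auto
  ultimately show ?thesis by (rule finite_imageD[rotated])
qed

text \<open>
  So the library's convention that a space of infinite dimension has dimension \<open>0\<close> plays no role.
\<close>

lemma finite_dim_HH_component:
  "\<exists>B. finite B \<and> HH_component \<chi> = HH_vs.span (B :: ('n::{finite,linorder}, 'k::field) HH set)"
proof -
  let ?S = "{std_cochain b \<alpha> | b \<alpha>. (\<exists>i. Poly_Mapping.lookup \<alpha> i = 0) \<and> mdeg b \<alpha> = \<chi>}
    :: (('n, 'k) resolution \<Rightarrow> ('n, 'k) coord_ring) set"
  have "?S \<subseteq> (\<lambda>(b, \<alpha>). std_cochain b \<alpha>) ` {(b, \<alpha>). mdeg b \<alpha> = \<chi>}"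
    by auto
  then have fin: "finite ?S"
    using finite_mdeg_fibre by (rule finite_subset[OF _ finite_imageI])
  obtain B where B: "B \<subseteq> cocycles \<inter> graded_cochains \<chi>" "cochain_vs.independent B"
      "cocycles \<inter> graded_cochains \<chi> \<subseteq> cochain_vs.span (B :: (('n, 'k) resolution \<Rightarrow> _) set)"
    by (rule cochain_vs.maximal_independent_subset)
  have finB: "finite B"
    using cochain_vs.independent_span_bound[OF fin B(2)] B(1) by (auto simp: graded_cochains_def)
  have "f \<in> cocycles \<and> abs_HH f \<in> HH_vs.span (abs_HH ` B)" if "f \<in> cochain_vs.span B" for f
    using that
  proof (induction rule: cochain_vs.span_induct_alt)
    case base
    then show ?case
      using cochain_vs.subspace_0[OF subspace_cocycles] HH_vs.span_zero
      by (auto simp only: zero_HH.abs_eq[symmetric])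
  next
    case (step c x y)
    then have "x \<in> cocycles" using B(1) by auto
    then have cx: "cochain_scale c x \<in> cocycles"
      by (rule cochain_vs.subspace_scale[OF subspace_cocycles])
    have "abs_HH (cochain_scale c x + y) = HH_scale c (abs_HH x) + abs_HH y"
      using step cx \<open>x \<in> cocycles\<close> by (simp only: abs_HH_add abs_HH_scale)
    moreover have "HH_scale c (abs_HH x) + abs_HH y \<in> HH_vs.span (abs_HH ` B)"
      using step by (intro HH_vs.span_add[OF HH_vs.span_scale[OF HH_vs.span_base]]) auto
    moreover have "cochain_scale c x + y \<in> cocycles"
      using step cx by (intro cochain_vs.subspace_add[OF subspace_cocycles]) auto
    ultimately show ?case by (simp only: simp_thms)
  qed
  then have "HH_component \<chi> \<subseteq> HH_vs.span (abs_HH ` B)"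
    using B(3) by (auto simp: HH_component_def)
  moreover have "HH_vs.span (abs_HH ` B) \<subseteq> HH_component \<chi>"
    using B(1) by (intro HH_vs.span_minimal subspace_HH_component) (auto simp: HH_component_def)
  ultimately show ?thesis using finB by blast
qed

lemma HH_component_bounded:
  assumes "HH_component (m, v) \<noteq> ({0} :: ('n::{finite,linorder}, 'k::field) HH set)"
  shows "- 1 - int m \<le> v i"
proof (rule ccontr)
  assume "\<not> - 1 - int m \<le> v i"
  then have "mdeg b \<alpha> \<noteq> (m, v)" for b :: "'n symb" and \<alpha>
    by (auto simp: mdeg_def split: if_splits prod.splits)
  then have "graded_cochains (m, v) = ({0} :: (('n, 'k) resolution \<Rightarrow> ('n, 'k) coord_ring) set)"
    by (simp add: graded_cochains_def)
  then have "HH_component (m, v) = ({0} :: ('n, 'k) HH set)"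
    using cochain_vs.subspace_0[OF subspace_cocycles]
    by (auto simp: HH_component_def zero_HH.abs_eq)
  with assms show False by simp
qed


section \<open>The ring $\mathbb{Z}[[a_1,\ldots,a_n]][(a_1 \cdots a_n)^{-1}]$\<close>

text \<open>
  Its elements are the functions of exponent vectors in \<open>\<int>\<^sup>n\<close> whose support is bounded below:
  multiplying by a power of \<open>a\<^sub>1 \<cdots> a\<^sub>n\<close> shifts all exponents by the same amount.
\<close>

definition supp_ge :: "int \<Rightarrow> (('n \<Rightarrow> int) \<Rightarrow> int) \<Rightarrow> bool" where
  "supp_ge N f \<longleftrightarrow> (\<forall>v. f v \<noteq> 0 \<longrightarrow> (\<forall>i. N \<le> v i))"

lemma supp_geD: "supp_ge N f \<Longrightarrow> f v \<noteq> 0 \<Longrightarrow> N \<le> v i"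
  by (simp add: supp_ge_def)

lemma supp_ge_mono: "supp_ge N f \<Longrightarrow> M \<le> N \<Longrightarrow> supp_ge M f"
  unfolding supp_ge_def by (intro allI impI, rule order_trans, assumption, simp)

lemma supp_ge_zero: "supp_ge N (\<lambda>_. 0)"
  by (simp add: supp_ge_def)

lemma supp_ge_uminus: "supp_ge N f \<Longrightarrow> supp_ge N (\<lambda>v. - f v)"
  by (simp add: supp_ge_def)

lemma supp_ge_add: "supp_ge N f \<Longrightarrow> supp_ge N g \<Longrightarrow> supp_ge N (\<lambda>v. f v + g v)"
  unfolding supp_ge_def
proof (intro allI impI)
  fix v i assume *: "\<forall>v. f v \<noteq> 0 \<longrightarrow> (\<forall>i. N \<le> v i)" "\<forall>v. g v \<noteq> 0 \<longrightarrow> (\<forall>i. N \<le> v i)"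
    and "f v + g v \<noteq> 0"
  then consider "f v \<noteq> 0" | "g v \<noteq> 0" by fastforce
  then show "N \<le> v i" by cases (simp_all add: *)
qed

lemma ex_supp_ge_add:
  assumes "\<exists>N. supp_ge N f" "\<exists>N. supp_ge N g"
  shows "\<exists>N. supp_ge N (\<lambda>v. f v + g v)"
proof -
  from assms obtain M N where *: "supp_ge M f" "supp_ge N g" by blast
  have "supp_ge (min M N) f" "supp_ge (min M N) g"
    using supp_ge_mono[OF *(1)] supp_ge_mono[OF *(2)] by simp_all
  then show ?thesis using supp_ge_add by blast
qed

lemma supp_ge_monom: "supp_ge (Min (range u)) (\<lambda>v. if v = (u :: 'n::finite \<Rightarrow> int) then 1 else 0)"
  by (simp add: supp_ge_def)

typedef 'n mlaurent = "{f :: ('n \<Rightarrow> int) \<Rightarrow> int. \<exists>N. supp_ge N f}"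
  morphisms mlaurent_coeff Abs_mlaurent
  using supp_ge_zero by blast

setup_lifting type_definition_mlaurent

definition conv :: "(('n \<Rightarrow> int) \<Rightarrow> int) \<Rightarrow> (('n \<Rightarrow> int) \<Rightarrow> int) \<Rightarrow> ('n \<Rightarrow> int) \<Rightarrow> int" where
  "conv f g v = (\<Sum>u | f u \<noteq> 0 \<and> g (v - u) \<noteq> 0. f u * g (v - u))"

lemma finite_box: "finite {u :: 'n::finite \<Rightarrow> int. \<forall>i. a i \<le> u i \<and> u i \<le> b i}"
proof -
  have "{u. \<forall>i. a i \<le> u i \<and> u i \<le> b i} = (\<Pi>\<^sub>E i\<in>UNIV. {a i..b i})"
    by (auto simp: PiE_def Pi_def extensional_def)
  then show ?thesis by (simp add: finite_PiE)
qed

lemma conv_superset: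
  assumes "finite S" "\<And>u. f u \<noteq> 0 \<Longrightarrow> g (v - u) \<noteq> 0 \<Longrightarrow> u \<in> S"
  shows "conv f g v = (\<Sum>u\<in>S. f u * g (v - u))"
  unfolding conv_def by (rule sum.mono_neutral_left) (use assms in auto)

lemma conv_shift:
  assumes "finite S" "\<And>w. f (w - u) \<noteq> 0 \<Longrightarrow> g (v - w) \<noteq> 0 \<Longrightarrow> w \<in> S"
  shows "conv f g (v - u) = (\<Sum>w\<in>S. f (w - u) * g (v - w))"
proof -
  have "conv f g (v - u) = (\<Sum>w\<in>(\<lambda>w. w - u) ` S. f w * g (v - u - w))"
  proof (rule conv_superset)
    fix w assume "f w \<noteq> 0" "g (v - u - w) \<noteq> 0"
    then have "w + u \<in> S" using assms(2)[of "w + u"] by (simp add: algebra_simps)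
    then show "w \<in> (\<lambda>w. w - u) ` S" by (intro image_eqI[of _ _ "w + u"]) simp_all
  qed (use assms in simp)
  also have "\<dots> = (\<Sum>w\<in>S. f (w - u) * g (v - w))"
    by (subst sum.reindex) (auto simp: inj_on_def algebra_simps)
  finally show ?thesis .
qed

lemma supp_ge_conv:
  assumes f: "supp_ge M f" and g: "supp_ge N g"
  shows "supp_ge (M + N) (conv f g)"
  unfolding supp_ge_def
proof (intro allI impI)
  fix v i assume "conv f g v \<noteq> 0"
  then obtain u where u: "f u \<noteq> 0" "g (v - u) \<noteq> 0"
    unfolding conv_def by (auto elim: sum.not_neutral_contains_not_neutral)
  show "M + N \<le> v i"
    using supp_geD[OF f, OF u(1), of i] supp_geD[OF g, OF u(2), of i] by simp
qed

lemma conv_box: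
  fixes f g :: "('n::finite \<Rightarrow> int) \<Rightarrow> int"
  assumes f: "supp_ge M f" and g: "supp_ge N g"
  shows "conv f g v = (\<Sum>u | \<forall>i. M \<le> u i \<and> u i \<le> v i - N. f u * g (v - u))"
proof (rule conv_superset)
  fix u assume *: "f u \<noteq> 0" "g (v - u) \<noteq> 0"
  have "M \<le> u i \<and> u i \<le> v i - N" for i
    using supp_geD[OF f, OF *(1), of i] supp_geD[OF g, OF *(2), of i] by simp
  then show "u \<in> {u. \<forall>i. M \<le> u i \<and> u i \<le> v i - N}" by blast
qed (rule finite_box)

lemma conv_commute: "conv f g v = conv g f v"
proof -
  have "conv f g v = (\<Sum>u\<in>(\<lambda>u. v - u) ` {u. g u \<noteq> 0 \<and> f (v - u) \<noteq> 0}. f u * g (v - u))"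
    unfolding conv_def
    by (rule arg_cong[where f = "sum _"]) (auto intro!: image_eqI[where x = "v - u" for u])
  also have "\<dots> = conv g f v"
    unfolding conv_def by (subst sum.reindex) (auto simp: inj_on_def mult.commute)
  finally show ?thesis .
qed

lemma conv_assoc:
  fixes f g h :: "('n::finite \<Rightarrow> int) \<Rightarrow> int"
  assumes f: "supp_ge K f" and g: "supp_ge M g" and h: "supp_ge N h"
  shows "conv (conv f g) h v = conv f (conv g h) v"
proof -
  let ?S = "{w. \<forall>i. K + M \<le> w i \<and> w i \<le> v i - N}"
  let ?T = "{u. \<forall>i. K \<le> u i \<and> u i \<le> v i - (M + N)}"
  have 1: "conv f g w = (\<Sum>u\<in>?T. f u * g (w - u))" if "w \<in> ?S" for w
  proof (rule conv_superset[OF finite_box])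
    fix u assume *: "f u \<noteq> 0" "g (w - u) \<noteq> 0"
    have "K \<le> u i \<and> u i \<le> v i - (M + N)" for i
      using supp_geD[OF f, OF *(1), of i] supp_geD[OF g, OF *(2), of i] that[simplified, rule_format, of i]
      by simp
    then show "u \<in> ?T" by blast
  qed
  have 2: "conv g h (v - u) = (\<Sum>w\<in>?S. g (w - u) * h (v - w))" if "u \<in> ?T" for u
  proof (rule conv_shift[OF finite_box])
    fix w assume *: "g (w - u) \<noteq> 0" "h (v - w) \<noteq> 0"
    have "K + M \<le> w i \<and> w i \<le> v i - N" for i
      using supp_geD[OF g, OF *(1), of i] supp_geD[OF h, OF *(2), of i] that[simplified, rule_format, of i]
      by simp
    then show "w \<in> ?S" by blast
  qed
  have "conv (conv f g) h v = (\<Sum>w\<in>?S. conv f g w * h (v - w))"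
    by (rule conv_box[OF supp_ge_conv[OF f g] h])
  also have "\<dots> = (\<Sum>w\<in>?S. \<Sum>u\<in>?T. f u * g (w - u) * h (v - w))"
    by (rule sum.cong) (simp_all add: 1 sum_distrib_right)
  also have "\<dots> = (\<Sum>u\<in>?T. \<Sum>w\<in>?S. f u * g (w - u) * h (v - w))"
    by (rule sum.swap)
  also have "\<dots> = (\<Sum>u\<in>?T. f u * conv g h (v - u))"
    by (rule sum.cong) (simp_all add: 2 sum_distrib_left mult.assoc)
  also have "\<dots> = conv f (conv g h) v"
    by (rule conv_box[OF f supp_ge_conv[OF g h], symmetric])
  finally show ?thesis .
qed

lemma conv_add_left:
  fixes f f' g :: "('n::finite \<Rightarrow> int) \<Rightarrow> int"
  assumes f: "supp_ge K f" and f': "supp_ge M f'" and g: "supp_ge N g"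
  shows "conv (\<lambda>u. f u + f' u) g v = conv f g v + conv f' g v"
proof -
  have *: "supp_ge (min K M) f" "supp_ge (min K M) f'"
    using supp_ge_mono[OF f] supp_ge_mono[OF f'] by simp_all
  show ?thesis
    unfolding conv_box[OF *(1) g] conv_box[OF *(2) g] conv_box[OF supp_ge_add[OF *] g]
    by (simp add: distrib_right sum.distrib)
qed

instantiation mlaurent :: (finite) comm_ring_1
begin

lift_definition zero_mlaurent :: "'a mlaurent" is "\<lambda>_. 0"
  using supp_ge_zero by blast
lift_definition one_mlaurent :: "'a mlaurent" is "\<lambda>v. if v = (\<lambda>_. 0) then 1 else 0"
  using supp_ge_monom by blast
lift_definition plus_mlaurent :: "'a mlaurent \<Rightarrow> 'a mlaurent \<Rightarrow> 'a mlaurent" is "\<lambda>f g v. f v + g v"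
  by (rule ex_supp_ge_add)
lift_definition uminus_mlaurent :: "'a mlaurent \<Rightarrow> 'a mlaurent" is "\<lambda>f v. - f v"
  using supp_ge_uminus by blast
definition minus_mlaurent :: "'a mlaurent \<Rightarrow> 'a mlaurent \<Rightarrow> 'a mlaurent" where
  "minus_mlaurent f g = f + - g"
lift_definition times_mlaurent :: "'a mlaurent \<Rightarrow> 'a mlaurent \<Rightarrow> 'a mlaurent" is conv
  using supp_ge_conv by blast

instance
proof
  fix f g h :: "'a mlaurent"
  show "f + g + h = f + (g + h)" "f + g = g + f" "0 + f = f" "- f + f = 0"
    by (transfer; simp add: fun_eq_iff)+
  show "f - g = f + - g" by (simp add: minus_mlaurent_def)
  show "(0 :: 'a mlaurent) \<noteq> 1" by transfer (auto dest: fun_cong[of _ _ "\<lambda>_. 0"])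
  show "f * g * h = f * (g * h)"
    by transfer (rule ext, elim exE, rule conv_assoc)
  show "f * g = g * f"
    by transfer (rule ext, rule conv_commute)
  show "(f + g) * h = f * h + g * h"
    by transfer (rule ext, elim exE, rule conv_add_left)
  show "1 * f = f"
  proof transfer
    fix f :: "('a \<Rightarrow> int) \<Rightarrow> int"
    have "conv (\<lambda>v. if v = (\<lambda>_. 0) then 1 else 0) f v = f v" for v
      by (subst conv_superset[of "{\<lambda>_. 0}"])
         (auto split: if_splits simp: fun_diff_def)
    then show "conv (\<lambda>v. if v = (\<lambda>_. 0) then 1 else 0) f = f" by (rule ext)
  qed
qed

end

lift_definition mlaurent_monom :: "('n \<Rightarrow> int) \<Rightarrow> 'n::finite mlaurent"
  is "\<lambda>u v. if v = u then 1 else 0"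
  using supp_ge_monom by blast

definition mlaurent_var :: "'n \<Rightarrow> 'n::finite mlaurent" where
  "mlaurent_var i = mlaurent_monom (\<lambda>j. if j = i then 1 else 0)"

lemma coeff_monom_mult: "mlaurent_coeff (mlaurent_monom u * f) v = mlaurent_coeff f (v - u)"
proof transfer
  fix u v and f :: "('a \<Rightarrow> int) \<Rightarrow> int"
  show "conv (\<lambda>v. if v = u then 1 else 0) f v = f (v - u)"
    by (subst conv_superset[of "{u}"]) (auto split: if_splits)
qed

lemma coeff_add: "mlaurent_coeff (f + g) v = mlaurent_coeff f v + mlaurent_coeff g v"
  by transfer simp

lemma coeff_diff: "mlaurent_coeff (f - g) v = mlaurent_coeff f v - mlaurent_coeff g v"
  unfolding minus_mlaurent_def by transfer simp

lemma monom_mult: "mlaurent_monom u * mlaurent_monom v = mlaurent_monom (u + v)"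
  by (rule mlaurent_coeff_inject[THEN iffD1], rule ext, unfold coeff_monom_mult, transfer)
     (auto simp: algebra_simps)

lemma monom_0: "mlaurent_monom 0 = 1"
  by transfer (simp add: zero_fun_def)

lemma prod_mlaurent_var: "(\<Prod>i\<in>UNIV. mlaurent_var i) = mlaurent_monom (\<lambda>_::'n::finite. 1)"
proof -
  have "(\<Prod>i\<in>S. mlaurent_var i) = mlaurent_monom (\<lambda>j::'n. if j \<in> S then 1 else 0)" if "finite S" for S
    using that
  proof (induction S)
    case empty
    then show ?case using monom_0 by (simp add: zero_fun_def)
  next
    case (insert i S)
    have "(\<lambda>j. if j = i then 1 else 0) + (\<lambda>j. if j \<in> S then 1 else 0)
        = (\<lambda>j. if j \<in> insert i S then 1 else 0 :: int)"
      using insert.hyps by (auto simp: fun_eq_iff)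
    then show ?case using insert by (simp add: mlaurent_var_def monom_mult)
  qed
  then show ?thesis by simp
qed

text \<open>\<open>\<Sum>\<^sub>j a\<^sub>i\<^sup>j\<close>\<close>

lift_definition geom_series :: "'n \<Rightarrow> 'n::finite mlaurent"
  is "\<lambda>i v. if 0 \<le> v i \<and> (\<forall>j. j \<noteq> i \<longrightarrow> v j = 0) then 1 else 0"
proof (rule exI[of _ 0])
  fix i :: 'n
  show "supp_ge 0 (\<lambda>v. if 0 \<le> v i \<and> (\<forall>j. j \<noteq> i \<longrightarrow> v j = 0) then 1 else 0)"
    unfolding supp_ge_def
  proof (intro allI impI)
    fix v :: "'n \<Rightarrow> int" and j
    assume "(if 0 \<le> v i \<and> (\<forall>j. j \<noteq> i \<longrightarrow> v j = 0) then 1 else 0 :: int) \<noteq> 0"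
    then show "0 \<le> v j" by (cases "j = i") (simp_all split: if_splits)
  qed
qed

lemma coeff_geom_series:
  "mlaurent_coeff (geom_series i) v = (if 0 \<le> v i \<and> (\<forall>j. j \<noteq> i \<longrightarrow> v j = 0) then 1 else 0)"
  by transfer (rule refl)

lemma coeff_one: "mlaurent_coeff 1 v = (if v = (\<lambda>_. 0) then 1 else 0)"
  by transfer (rule refl)

lemma geom_series_inverse: "(1 - mlaurent_var i) * geom_series i = 1"
proof (rule mlaurent_coeff_inject[THEN iffD1], rule ext)
  fix v
  have "mlaurent_coeff ((1 - mlaurent_var i) * geom_series i) v
      = mlaurent_coeff (geom_series i) v - mlaurent_coeff (geom_series i) (v - (\<lambda>j. if j = i then 1 else 0))"
    by (simp add: left_diff_distrib coeff_diff mlaurent_var_def coeff_monom_mult)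
  also have "\<dots> = mlaurent_coeff 1 v"
  proof (cases "\<forall>j. j \<noteq> i \<longrightarrow> v j = 0")
    case True
    then have "v = (\<lambda>_. 0) \<longleftrightarrow> v i = 0" by (metis ext)
    with True show ?thesis by (simp add: coeff_geom_series coeff_one)
  next
    case False
    then obtain j where "j \<noteq> i" "v j \<noteq> 0" by blast
    then have "v \<noteq> (\<lambda>_. 0)" "\<not> (\<forall>j. j \<noteq> i \<longrightarrow> (v - (\<lambda>j. if j = i then 1 else 0)) j = 0)" by auto
    with False show ?thesis by (simp only: coeff_geom_series coeff_one if_False simp_thms diff_self)
  qed
  finally show "mlaurent_coeff ((1 - mlaurent_var i) * geom_series i) v = mlaurent_coeff 1 v" .
qed


section \<open>Hilbert series\<close>

text \<open>
  The ring of the series is \<^typ>\<open>'n mlaurent fps\<close>, with \<open>a\<^sub>0\<close> the variable \<^term>\<open>fps_X\<close>.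
\<close>

definition hilbert_series ::
  "('k::field \<Rightarrow> 'v::ab_group_add \<Rightarrow> 'v) \<Rightarrow> (nat \<times> ('n \<Rightarrow> int) \<Rightarrow> 'v set) \<Rightarrow> 'n::finite mlaurent fps" where
  "hilbert_series scale V = Abs_fps (\<lambda>m. Abs_mlaurent (\<lambda>v. int (vector_space.dim scale (V (m, v)))))"

lemma coeff_hilbert_series_HH:
  "mlaurent_coeff (fps_nth (hilbert_series HH_scale
       (HH_component :: _ \<Rightarrow> ('n::{finite,linorder}, 'k::field) HH set)) m) v
     = int (HH_vs.dim (HH_component (m, v) :: ('n, 'k) HH set))"
proof -
  have "supp_ge (- 1 - int m) (\<lambda>v. int (HH_vs.dim (HH_component (m, v) :: ('n, 'k) HH set)))"
    unfolding supp_ge_def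
  proof (intro allI impI)
    fix v :: "'n \<Rightarrow> int" and i
    assume "int (HH_vs.dim (HH_component (m, v) :: ('n, 'k) HH set)) \<noteq> 0"
    then have "HH_component (m, v) \<noteq> ({0} :: ('n, 'k) HH set)"
      using HH_vs.dim_eq_card[of "{}" "{0} :: ('n, 'k) HH set"] by (auto simp: HH_vs.independent_empty)
    then show "- 1 - int m \<le> v i" by (rule HH_component_bounded)
  qed
  then have "(\<lambda>v. int (HH_vs.dim (HH_component (m, v) :: ('n, 'k) HH set))) \<in> {f. \<exists>N. supp_ge N f}"
    by blast
  then show ?thesis
    by (simp only: hilbert_series_def fps_nth_Abs_fps Abs_mlaurent_inverse)
qed

definition avar0 :: "'n::finite mlaurent fps" where
  "avar0 = fps_X"

definition avar :: "'n \<Rightarrow> 'n::finite mlaurent fps" where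
  "avar i = fps_const (mlaurent_var i)"

text \<open>The expansion of \<open>1 / (1 - a\<^sub>i)\<close>.\<close>

definition inv_one_minus_var :: "'n \<Rightarrow> 'n::finite mlaurent fps" where
  "inv_one_minus_var i = fps_const (geom_series i)"

text \<open>
  The expansion of \<open>1 / (a\<^sub>1 \<cdots> a\<^sub>n - a\<^sub>0\<^sup>2)\<close>: the coefficient of \<open>a\<^sub>0\<^sup>2\<^sup>q\<close> is \<open>(a\<^sub>1 \<cdots> a\<^sub>n)\<^sup>-\<^sup>q\<^sup>-\<^sup>1\<close>.
\<close>

definition inv_prod_minus_square :: "'n::finite mlaurent fps" where
  "inv_prod_minus_square =
     Abs_fps (\<lambda>m. if even m then mlaurent_monom (\<lambda>_. - int (m div 2) - 1) else 0)"

lemma inv_one_minus_var: "(1 - avar i) * inv_one_minus_var i = 1"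
proof -
  have "(1 - avar i) * inv_one_minus_var i = fps_const ((1 - mlaurent_var i) * geom_series i)"
    by (simp add: avar_def inv_one_minus_var_def fps_const_mult fps_const_sub flip: fps_const_1_eq_1)
  then show ?thesis by (simp add: geom_series_inverse)
qed

lemma prod_var: "(\<Prod>i\<in>UNIV. avar i) = fps_const (mlaurent_monom (\<lambda>_::'n::finite. 1))"
proof -
  have "(\<Prod>i\<in>S. avar i) = fps_const (\<Prod>i\<in>S. mlaurent_var (i::'n))" if "finite S" for S
    using that by (induction S) (simp_all add: avar_def)
  then show ?thesis by (simp add: prod_mlaurent_var)
qed

lemma inv_prod_minus_square:
  "((\<Prod>i\<in>UNIV. avar i) - avar0 ^ 2) * inv_prod_minus_square = (1 :: 'n::finite mlaurent fps)"
proof (rule fps_ext)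
  fix m
  have nth: "fps_nth (((\<Prod>i\<in>UNIV. avar i) - avar0 ^ 2) * inv_prod_minus_square :: 'n mlaurent fps) m
      = mlaurent_monom (\<lambda>_. 1) * fps_nth inv_prod_minus_square m
        - (if m < 2 then 0 else fps_nth inv_prod_minus_square (m - 2))"
    unfolding prod_var left_diff_distrib avar0_def by (simp add: fps_X_power_mult_nth)
  have "mlaurent_monom (\<lambda>_. 1) * mlaurent_monom (\<lambda>_. - int (m div 2) - 1)
      = (mlaurent_monom (\<lambda>_. - int (m div 2)) :: 'n mlaurent)"
    unfolding monom_mult by (simp add: plus_fun_def)
  moreover have "- int ((m - 2) div 2) - 1 = - int (m div 2)" if "2 \<le> m"
    using that by linarith
  moreover have "m = 0 \<or> m = 1 \<or> 2 \<le> m" by linarith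
  moreover have "mlaurent_monom (\<lambda>_. 0) = (1 :: 'n mlaurent)"
    using monom_0 by (simp only: zero_fun_def)
  ultimately show "fps_nth (((\<Prod>i\<in>UNIV. avar i) - avar0 ^ 2) * inv_prod_minus_square :: 'n mlaurent fps) m
      = fps_nth 1 m"
    unfolding nth by (auto simp: inv_prod_minus_square_def zero_fun_def)
qed

end

theory Submission
  imports Defs
begin

text \<open>
  Both tensor factors act on \<open>A\<close> by multiplication, so the Koszul part of the differential dies in
  \<open>Hom(F, A)\<close> and \<open>\<partial>(e\<^sub>J t\<^sup>(\<^sup>p\<^sup>), x\<^sup>\<alpha>) = \<Sum>\<^sub>j\<^sub>\<in>\<^sub>J \<plusminus>(e\<^sub>J\<^sub>-\<^sub>j t\<^sup>(\<^sup>p\<^sup>+\<^sup>1\<^sup>), x\<^sup>\<alpha> \<Prod>\<^sub>i\<^sub>\<noteq>\<^sub>j x\<^sub>i)\<close>, where the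
  term of \<open>j\<close> vanishes unless \<open>\<alpha>\<^sub>j = 0\<close>. Fix the last \<open>n\<close> coordinates \<open>v\<close> of the multidegree, let
  \<open>-q\<close> be their minimum and \<open>Z\<close> the set of indices where it is attained. If \<open>q < 0\<close> there are no
  standard elements. Otherwise they are determined by their symbols, which are the \<open>e\<^sub>J t\<^sup>(\<^sup>q\<^sup>-\<^sup>1\<^sup>)\<close> with
  \<open>Z \<subseteq> J\<close> and the \<open>e\<^sub>I t\<^sup>(\<^sup>q\<^sup>)\<close> with \<open>\<not> Z \<subseteq> I\<close>; the latter are cocycles, and the former are mapped to
  \<open>\<Sum>\<^sub>j\<^sub>\<in>\<^sub>Z \<plusminus>e\<^sub>J\<^sub>-\<^sub>j t\<^sup>(\<^sup>q\<^sup>)\<close>. These relations eliminate the \<open>e\<^sub>I t\<^sup>(\<^sup>q\<^sup>)\<close> with \<open>Z - I = {j\<^sub>0}\<close> for a fixed \<open>j\<^sub>0 \<in> Z\<close>, so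
  the cohomology has as basis the \<open>e\<^sub>I t\<^sup>(\<^sup>q\<^sup>)\<close> with \<open>\<not> W \<subseteq> I\<close>, where \<open>W = Z - {j\<^sub>0}\<close> (and \<open>W = Z\<close> if
  \<open>q = 0\<close>). It remains to count and to compare with the coefficients of the rational function.
\<close>

section \<open>Coefficients of elements of $A$\<close>

text \<open>The monomials divisible by \<open>x\<^sub>1 \<cdots> x\<^sub>n\<close> vanish in \<open>A\<close>; their coefficients are set to \<open>0\<close>.\<close>

context includes coord_ring.lifting begin

lift_definition coord_coeff :: "('n \<Rightarrow>\<^sub>0 nat) \<Rightarrow> ('n::finite, 'k::field) coord_ring \<Rightarrow> 'k"
  is "\<lambda>\<alpha> p. if 0 \<in> range (Poly_Mapping.lookup \<alpha>) then Poly_Mapping.lookup p \<alpha> else 0"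
proof -
  fix \<alpha> :: "'n \<Rightarrow>\<^sub>0 nat" and p q :: "('n, 'k) mpoly"
  assume "(\<Prod>i\<in>UNIV. mpoly_var i) dvd p - q"
  then obtain r where r: "p - q = Poly_Mapping.single (\<Sum>i\<in>UNIV. Poly_Mapping.single i 1) 1 * r"
    unfolding prod_mpoly_var by (elim dvdE)
  have "Poly_Mapping.lookup (p - q) \<alpha> = 0" if i: "Poly_Mapping.lookup \<alpha> i = 0" for i
  proof (rule ccontr)
    assume "Poly_Mapping.lookup (p - q) \<alpha> \<noteq> 0"
    then have "\<alpha> \<in> Poly_Mapping.keys (p - q)" by (simp add: in_keys_iff)
    then obtain b where "\<alpha> = (\<Sum>i\<in>UNIV. Poly_Mapping.single i 1) + b"
      using keys_mult[of "Poly_Mapping.single (\<Sum>i\<in>UNIV. Poly_Mapping.single i 1) 1" r]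
      unfolding r by (auto split: if_splits)
    with i show False by (simp add: lookup_add lookup_sum lookup_single when_def)
  qed
  then show "(if 0 \<in> range (Poly_Mapping.lookup \<alpha>) then Poly_Mapping.lookup p \<alpha> else 0)
    = (if 0 \<in> range (Poly_Mapping.lookup \<alpha>) then Poly_Mapping.lookup q \<alpha> else 0)"
    by (auto simp: lookup_minus)
qed

end

lemma coord_coeff_add: "coord_coeff \<alpha> (x + y) = coord_coeff \<alpha> x + coord_coeff \<alpha> y"
  by (induction x rule: coord_ring.abs_induct; induction y rule: coord_ring.abs_induct)
     (simp add: plus_coord_ring.abs_eq coord_coeff.abs_eq lookup_add)

text \<open>By additivity in \<open>p\<close> a single term suffices. Exponents are subtracted with
  truncation, so \<open>\<alpha> - \<beta>\<close> is meaningful only where the monomial of \<beta>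
  divides that of \<alpha>.\<close>

lemma lookup_single_mult:
  fixes p :: "('n, 'k::field) mpoly"
  shows "Poly_Mapping.lookup (Poly_Mapping.single \<beta> c * p) \<alpha>
     = (if \<forall>i. Poly_Mapping.lookup \<beta> i \<le> Poly_Mapping.lookup \<alpha> i
        then c * Poly_Mapping.lookup p (\<alpha> - \<beta>) else 0)"
proof (induction p rule: poly_mapping_add_induct)
  case (single \<gamma> d)
  have "\<beta> + \<gamma> = \<alpha> \<longleftrightarrow>
    (\<forall>i. Poly_Mapping.lookup \<beta> i \<le> Poly_Mapping.lookup \<alpha> i) \<and> \<gamma> = \<alpha> - \<beta>"
  proof -
    have "a + b = c \<longleftrightarrow> a \<le> c \<and> b = c - a" for a b c :: nat by auto
    then show ?thesis
      by (simp add: poly_mapping_eq_iff fun_eq_iff lookup_add lookup_minus all_conj_distrib)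
  qed
  then show ?case
    by (auto simp: mult_single lookup_single when_def)
qed (simp_all add: distrib_left lookup_add)

lemma coord_coeff_scale: "coord_coeff \<alpha> (coord_scale c x) = c * coord_coeff \<alpha> x"
  by (induction x rule: coord_ring.abs_induct)
     (simp add: coord_scale.abs_eq coord_coeff.abs_eq lookup_single_mult)

lemma coord_coeff_monom:
  "0 \<in> range (Poly_Mapping.lookup \<alpha>) \<Longrightarrow>
    coord_coeff \<alpha> (coord_monom \<beta>) = (if \<alpha> = \<beta> then 1 else 0)"
  by (auto simp: coord_monom.abs_eq coord_coeff.abs_eq lookup_single when_def)

text \<open>A zero exponent of \<alpha> persists in \<open>\<alpha> - \<beta>\<close>, so both
  coefficients are read off a representative and neither is the default value 0.\<close>

lemma coord_coeff_monom_mult: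
  assumes "0 \<in> range (Poly_Mapping.lookup \<alpha>)"
  shows "coord_coeff \<alpha> (coord_monom \<beta> * x)
    = (if \<forall>i. Poly_Mapping.lookup \<beta> i \<le> Poly_Mapping.lookup \<alpha> i
       then coord_coeff (\<alpha> - \<beta>) x else 0)"
proof (induction x rule: coord_ring.abs_induct)
  case (1 p)
  have "0 \<in> range (Poly_Mapping.lookup (\<alpha> - \<beta>))"
  proof -
    obtain i where "Poly_Mapping.lookup \<alpha> i = 0" using assms by auto
    then have "Poly_Mapping.lookup (\<alpha> - \<beta>) i = 0" by (simp add: lookup_minus)
    then show ?thesis by (metis rangeI)
  qed
  then show ?case
    using assms unfolding coord_monom.abs_eq times_coord_ring.abs_eq coord_coeff.abs_eq lookup_single_mult
    by (simp only: if_True mult_1)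
qed

lemma coord_monom_mult: "coord_monom \<alpha> * coord_monom \<beta> = coord_monom (\<alpha> + \<beta>)"
  by (simp add: coord_monom.abs_eq times_coord_ring.abs_eq mult_single)

lemma coord_monom_0: "coord_monom 0 = 1"
  by (simp add: coord_monom.abs_eq one_coord_ring.abs_eq)

lemma coord_monom_eq_0:
  assumes nz: "\<And>i. Poly_Mapping.lookup \<alpha> i \<noteq> 0"
  shows "(coord_monom \<alpha> :: ('n::finite, 'k::field) coord_ring) = 0"
proof -
  let ?u = "\<Sum>i\<in>UNIV. Poly_Mapping.single (i::'n) (1::nat)"
  have "\<alpha> = ?u + (\<alpha> - ?u)"
    by (rule poly_mapping_eqI)
       (use nz in \<open>simp add: lookup_add lookup_minus lookup_sum lookup_single when_def Suc_le_eq\<close>)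
  then have "Poly_Mapping.single \<alpha> (1::'k) = Poly_Mapping.single ?u 1 * Poly_Mapping.single (\<alpha> - ?u) 1"
    by (simp add: mult_single)
  then have "(\<Prod>i\<in>UNIV. mpoly_var i) dvd Poly_Mapping.single \<alpha> (1::'k) - 0"
    unfolding prod_mpoly_var by (metis diff_zero dvd_triv_left)
  then show ?thesis
    by (simp add: coord_monom.abs_eq zero_coord_ring.abs_eq coord_ring.abs_eq_iff)
qed

lemma coord_coeff_0 [simp]: "coord_coeff \<alpha> 0 = 0"
  using coord_coeff_scale[of \<alpha> 0 0] by simp

lemma coord_coeff_sum: "coord_coeff \<alpha> (sum f S) = (\<Sum>i\<in>S. coord_coeff \<alpha> (f i))"
  by (induction S rule: infinite_finite_induct) (simp_all add: coord_coeff_add)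

text \<open>Exponent vector of the product of all \<open>x_i\<close> with
  \<open>i \<noteq> j\<close>, which is how the coefficient of the wedge with \<open>e_j\<close> in
  the differential acts on A.\<close>

definition cofactor :: "'n::finite \<Rightarrow> 'n \<Rightarrow>\<^sub>0 nat" where
  "cofactor j = (\<Sum>i\<in>UNIV - {j}. Poly_Mapping.single i 1)"

lemma lookup_cofactor: "Poly_Mapping.lookup (cofactor j) i = (if i = j then 0 else 1)"
  by (simp add: cofactor_def lookup_sum lookup_single when_def)

lemma prod_coord_var:
  "(\<Prod>i\<in>S. coord_var i) = coord_monom (\<Sum>i\<in>S. Poly_Mapping.single i 1)"
  by (induction S rule: infinite_finite_induct)
     (simp_all add: coord_monom_0 coord_var_def coord_monom_mult)

lemma prod_coord_var_cofactor:
  fixes j :: "'n::{finite,linorder}"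
  shows "(\<Prod>i\<in>{..<j}. coord_var i) * (\<Prod>i\<in>{j<..}. coord_var i) = coord_monom (cofactor j)"
proof -
  have "UNIV - {j} = {..<j} \<union> {j<..}" "{..<j} \<inter> {j<..} = {}" by auto
  then have "cofactor j = (\<Sum>i\<in>{..<j}. Poly_Mapping.single i 1) + (\<Sum>i\<in>{j<..}. Poly_Mapping.single i 1)"
    unfolding cofactor_def by (simp add: sum.union_disjoint)
  then show ?thesis by (simp add: prod_coord_var coord_monom_mult)
qed

section \<open>The coboundary\<close>

lemma resolution_expand:
  "z = (\<Sum>b\<in>Poly_Mapping.keys z. res_scale (Poly_Mapping.lookup z b) (res_basis b))"
  by (rule poly_mapping_eqI)
     (auto simp: lookup_sum res_basis_def lookup_single when_def in_keys_iff if_distrib cong: if_cong)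

text \<open>Linear maps on a free module are determined by their values on the basis, and the
  differential is the linear extension of \<open>res_diff_basis\<close>.\<close>

lemma coboundary_eqI:
  assumes f: "module_hom res_scale env_act f" and g: "module_hom res_scale env_act g"
    and eq: "\<And>b. f (res_diff_basis b) = g (res_basis b)"
  shows "coboundary f = g"
proof
  fix z
  interpret f: module_hom res_scale env_act f by (rule f)
  interpret g: module_hom res_scale env_act g by (rule g)
  have "coboundary f z = (\<Sum>b\<in>Poly_Mapping.keys z. env_act (Poly_Mapping.lookup z b) (g (res_basis b)))"
    by (simp add: coboundary_def res_diff_def f.sum f.scale eq)
  also have "\<dots> = g z"
    by (subst (3) resolution_expand) (simp add: g.sum g.scale)
  finally show "coboundary f z = g z" .
qed

lemma env_act_minus_one_power: "env_act ((-1) ^ k) x = coord_scale ((-1) ^ k) x"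
proof (induction k)
  case (Suc k)
  have "env_act ((-1) ^ Suc k) x = - env_act ((-1) ^ k) x"
    by simp
  then show ?case using Suc by simp
qed simp

text \<open>The Koszul summand vanishes because A is commutative. In the other summand the two
  tensor factors merge into the cofactor monomial, and \<open>j \<in> I\<close> contributes nothing
  since the wedge is zero.\<close>

lemma hom_res_diff_basis:
  fixes f :: "('n::{finite,linorder}, 'k::field) resolution \<Rightarrow> ('n, 'k) coord_ring"
  assumes "module_hom res_scale env_act f"
  shows "f (res_diff_basis (I, q)) = (if q = 0 then 0 else
    (\<Sum>j\<in>- I. coord_scale ((-1) ^ card {i\<in>I. i < j})
       (coord_monom (cofactor j) * f (res_basis (insert j I, q - 1)))))"
proof -
  interpret f: module_hom res_scale env_act f by (rule assms)
  have 1: "env_act (s * (1 \<otimes>\<^sub>k coord_var i - coord_var i \<otimes>\<^sub>k 1)) x = 0"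
    for s i and x :: "('n, 'k) coord_ring"
    by (simp add: env_act_tensor env_module.scale_left_diff_distrib mult.commute
        flip: env_module.scale_scale)
  have 2: "env_act ((\<Prod>i\<in>{..<j}. coord_var i) \<otimes>\<^sub>k (\<Prod>i\<in>{j<..}. coord_var i)) (f (wedge j I (q - 1)))
    = (if j \<in> I then 0 else coord_scale ((-1) ^ card {i\<in>I. i < j})
       (coord_monom (cofactor j) * f (res_basis (insert j I, q - 1))))" for j
  proof -
    have "a * coord_scale c x * b = coord_scale c (a * b * x)" for a b x :: "('n, 'k) coord_ring" and c
      by (simp add: coord_scale_mult_left coord_scale_mult_right mult.assoc mult.commute[of x b])
    then show ?thesis
      by (simp add: wedge_def f.scale env_act_minus_one_power env_act_tensor prod_coord_var_cofactor)
  qed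
  have A: "f (\<Sum>i\<in>I. res_scale ((-1) ^ card {i'\<in>I. i' < i} * (1 \<otimes>\<^sub>k coord_var i - coord_var i \<otimes>\<^sub>k 1))
      (res_basis (I - {i}, q))) = 0"
    by (simp only: f.sum f.scale 1 sum.neutral_const)
  have B: "f (\<Sum>j\<in>UNIV. res_scale ((\<Prod>i\<in>{..<j}. coord_var i) \<otimes>\<^sub>k (\<Prod>i\<in>{j<..}. coord_var i)) (wedge j I (q - 1)))
    = (\<Sum>j\<in>UNIV. if j \<in> I then 0 else coord_scale ((-1) ^ card {i\<in>I. i < j})
       (coord_monom (cofactor j) * f (res_basis (insert j I, q - 1))))"
    unfolding f.sum f.scale by (rule sum.cong[OF refl]) (rule 2)
  have C: "(\<Sum>j\<in>UNIV. if j \<in> I then 0 else g j) = (\<Sum>j\<in>- I. g j)" for g :: "'n \<Rightarrow> ('n, 'k) coord_ring"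
    by (rule sum.mono_neutral_cong_right) auto
  show ?thesis
    unfolding res_diff_basis_def prod.case f.add A using B unfolding C by (cases "q = 0") simp_all
qed

lemma module_hom_std_cochain: "module_hom res_scale env_act (std_cochain b \<alpha>)"
  using std_cochain_cochains[of b \<alpha>] unfolding cochains_def by blast

lemma module_hom_sum_scale:
  fixes f :: "'i \<Rightarrow> ('n::finite, 'k::field) resolution \<Rightarrow> ('n, 'k) coord_ring"
  assumes "\<And>i. i \<in> S \<Longrightarrow> f i \<in> cochains"
  shows "module_hom res_scale env_act (\<Sum>i\<in>S. cochain_scale (c i) (f i))"
proof -
  have "(\<Sum>i\<in>S. cochain_scale (c i) (f i)) \<in> cochains"
    by (intro cochain_vs.subspace_sum cochain_vs.subspace_scale subspace_cochains assms)
  then show ?thesis by (simp add: cochains_def)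
qed

lemma res_diff_res_basis: "res_diff (res_basis b) = res_diff_basis b"
  by (simp add: res_diff_def res_basis_def)

lemma coboundary_basis: "coboundary f (res_basis b) = f (res_diff_basis b)"
  by (simp add: coboundary_def res_diff_res_basis)

lemma sum_cochain_apply:
  "(\<Sum>i\<in>S. cochain_scale (c i) (f i)) z = (\<Sum>i\<in>S. coord_scale (c i) (f i z))"
  by (induction S rule: infinite_finite_induct) (simp_all add: cochain_scale_def)

text \<open>Transposed form of the differential: \<open>(J, p)\<close> occurs in the differential of
  \<open>(I, q)\<close>, outside the Koszul part, only if \<open>q = Suc p\<close> and
  \<open>I\<close> is \<open>J\<close> without one element \<open>j\<close>.\<close>

lemma coboundary_std_cochain:
  fixes J :: "'n::{finite,linorder} set"
  shows "coboundary (std_cochain (J, p) \<alpha> :: ('n, 'k::field) resolution \<Rightarrow> ('n, 'k) coord_ring)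
    = (\<Sum>j\<in>J. cochain_scale ((-1) ^ card {i\<in>J. i < j})
        (std_cochain (J - {j}, Suc p) (\<alpha> + cofactor j)))"
proof (rule coboundary_eqI[OF module_hom_std_cochain module_hom_sum_scale[OF std_cochain_cochains]])
  fix b :: "'n symb"
  obtain I q where b: "b = (I, q)" by (cases b)
  let ?c = "\<lambda>j I. (-1) ^ card {i\<in>I. i < j} :: 'k"
  let ?m = "\<lambda>j. coord_monom (\<alpha> + cofactor j) :: ('n, 'k) coord_ring"
  have "std_cochain (J, p) \<alpha> (res_diff_basis b)
      = (\<Sum>j\<in>- I. coord_scale (?c j I) (if q = Suc p \<and> insert j I = J then ?m j else 0))"
    by (auto simp: b hom_res_diff_basis[OF module_hom_std_cochain] std_cochain_basis coord_monom_mult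
        add.commute intro!: sum.cong)
  also have "\<dots> = (\<Sum>j\<in>UNIV. if q = Suc p \<and> j \<in> J \<and> I = J - {j} then coord_scale (?c j J) (?m j) else 0)"
  proof (rule sum.mono_neutral_cong_left)
    fix j assume "j \<in> - I"
    then have "insert j I = J \<longleftrightarrow> j \<in> J \<and> I = J - {j}" by blast
    \<comment> \<open>The sign counts elements strictly below \<open>j\<close>, so removing
      \<open>j\<close> does not change it.\<close>
    moreover have "?c j (J - {j}) = ?c j J" by (rule arg_cong[where f = "\<lambda>S. _ ^ card S"]) auto
    ultimately show "coord_scale (?c j I) (if q = Suc p \<and> insert j I = J then ?m j else 0)
      = (if q = Suc p \<and> j \<in> J \<and> I = J - {j} then coord_scale (?c j J) (?m j) else 0)"
      by auto
  qed auto
  also have "\<dots> = (\<Sum>j\<in>J. coord_scale (?c j J) (std_cochain (J - {j}, Suc p) (\<alpha> + cofactor j) (res_basis b)))"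
    by (rule sum.mono_neutral_cong_right) (auto simp: b std_cochain_basis)
  finally show "std_cochain (J, p) \<alpha> (res_diff_basis b) =
    (\<Sum>j\<in>J. cochain_scale (?c j J) (std_cochain (J - {j}, Suc p) (\<alpha> + cofactor j))) (res_basis b)"
    by (simp add: sum_cochain_apply)
qed

section \<open>Classes of cocycles, and a dimension criterion\<close>

lemma abs_HH_eq_0:
  assumes "f \<in> cocycles" shows "abs_HH f = 0 \<longleftrightarrow> f \<in> coboundaries"
proof -
  have "0 \<in> cocycles" "0 \<in> coboundaries"
    by (rule cochain_vs.subspace_0, rule subspace_cocycles subspace_coboundaries)+
  then show ?thesis
    unfolding zero_HH.abs_eq using assms Quotient3_rel[OF Quotient3_HH, of f 0] by auto
qed

text \<open>\<open>abs_HH\<close> is additive on cocycles, so the induction has to carry along that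
  the partial sums are cocycles.\<close>

lemma abs_HH_sum:
  assumes "finite S" "\<forall>i\<in>S. f i \<in> cocycles"
  shows "(\<Sum>i\<in>S. cochain_scale (c i) (f i)) \<in> cocycles \<and>
    abs_HH (\<Sum>i\<in>S. cochain_scale (c i) (f i)) = (\<Sum>i\<in>S. HH_scale (c i) (abs_HH (f i)))"
  using assms
proof (induction S)
  case empty
  then show ?case
    using cochain_vs.subspace_0[OF subspace_cocycles]
    by (simp only: sum.empty zero_HH.abs_eq simp_thms)
next
  case (insert i S)
  then show ?case
    by (simp add: abs_HH_add abs_HH_scale cochain_vs.subspace_add cochain_vs.subspace_scale
        subspace_cocycles del: plus_fun_apply)
qed

lemma coboundary_std_in_coboundaries: "coboundary (std_cochain b \<alpha>) \<in> coboundaries"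
  by (simp add: coboundaries_def std_cochain_cochains)

text \<open>Independence is assumed of the family rather than of the set of its values; this also
  excludes repetitions, so the image has as many elements as \<open>X\<close>.\<close>

lemma (in vector_space) dim_span_image_eq_card:
  assumes fin: "finite X"
    and indep: "\<And>c. (\<Sum>x\<in>X. scale (c x) (b x)) = 0 \<Longrightarrow> \<forall>x\<in>X. c x = 0"
  shows "dim (span (b ` X)) = card X"
proof -
  have inj: "inj_on b X"
  proof (rule inj_onI, rule ccontr)
    fix x y assume *: "x \<in> X" "y \<in> X" "b x = b y" "x \<noteq> y"
    \<comment> \<open>If \<open>b x = b y\<close>, the coefficients 1 at \<open>x\<close> and -1 at
      \<open>y\<close> give a nontrivial relation.\<close>
    let ?c = "\<lambda>z. (if z = x then 1 else 0) - (if z = y then 1 else 0) :: 'a"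
    have "(\<Sum>z\<in>X. scale (?c z) (b z)) =
      (\<Sum>z\<in>X. if z = x then b z else 0) - (\<Sum>z\<in>X. if z = y then b z else 0)"
      unfolding sum_subtractf[symmetric] by (rule sum.cong) (auto simp: scale_left_diff_distrib)
    also have "\<dots> = 0" using * fin by simp
    finally have "\<forall>z\<in>X. ?c z = 0" by (rule indep[of ?c])
    with * show False by force
  qed
  have "independent (b ` X)"
  proof
    assume "dependent (b ` X)"
    then obtain u x where x: "x \<in> X" "u (b x) \<noteq> 0" and "(\<Sum>y\<in>b ` X. scale (u y) y) = 0"
      using fin by (auto simp: dependent_finite)
    then have "(\<Sum>y\<in>X. scale (u (b y)) (b y)) = 0"
      by (simp add: sum.reindex[OF inj])
    with indep[of "\<lambda>y. u (b y)"] x show False by blast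
  qed
  then show ?thesis by (simp add: dim_eq_card_independent card_image inj)
qed

section \<open>The component of a multidegree\<close>

text \<open>
  The multidegrees \<open>(m, v)\<close> with \<open>v\<^sub>i = u\<^sub>i - q\<close>; as \<open>u\<close> has a zero, \<open>-q\<close> is the minimum of the \<open>v\<^sub>i\<close>.
\<close>

locale degree_fibre =
  fixes u :: "'n::{finite,linorder} \<Rightarrow> nat" and q :: nat and j0 :: 'n
  assumes j0: "u j0 = 0"
begin

definition Z :: "'n set" where "Z = {i. u i = 0}"

text \<open>Solves \<alpha>_i - \<epsilon>_i - p = u_i - q for \<alpha>, where
  \<open>b = (I, p)\<close>. The subtraction truncates, so this is a true solution only if q \<le>
  u_i + \<epsilon>_i + p for all i.\<close>

definition exponent :: "'n symb \<Rightarrow> 'n \<Rightarrow>\<^sub>0 nat" where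
  "exponent b = Abs_poly_mapping (\<lambda>i. u i + (if i \<in> fst b then 1 else 0) + snd b - q)"

definition std :: "'n symb \<Rightarrow> ('n, 'k::field) resolution \<Rightarrow> ('n, 'k) coord_ring" where
  "std b = std_cochain b (exponent b)"

text \<open>
  For \<open>q = 0\<close> there are no symbols \<open>e\<^sub>J t\<^sup>(\<^sup>q\<^sup>-\<^sup>1\<^sup>)\<close>, and hence no relations.
\<close>

definition W :: "'n set" where "W = (if q = 0 then Z else Z - {j0})"

lemma j0_in_Z: "j0 \<in> Z"
  by (simp add: Z_def j0)

lemma lookup_exponent:
  "Poly_Mapping.lookup (exponent b) i = u i + (if i \<in> fst b then 1 else 0) + snd b - q"
  by (simp add: exponent_def Abs_poly_mapping_inverse)

text \<open>Nonnegative exponents with at least one zero mean that \<open>q - p\<close> is the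
  minimum of u_i + \<epsilon>_i, where \<open>b = (I, p)\<close>. This minimum is 1 if
  \<open>I\<close> contains \<open>Z\<close> and 0 otherwise.\<close>

lemma mdeg_fibre:
  "(\<exists>i. Poly_Mapping.lookup \<alpha> i = 0) \<and> mdeg b \<alpha> = (m, \<lambda>i. int (u i) - int q) \<longleftrightarrow>
   symb_degree b = m \<and> \<alpha> = exponent b \<and>
     (if Z \<subseteq> fst b then Suc (snd b) = q else snd b = q)"
proof -
  obtain I p where b: "b = (I, p)" by (cases b)
  let ?e = "\<lambda>i. u i + (if i \<in> I then 1 else 0)"
  have "mdeg b \<alpha> = (m, \<lambda>i. int (u i) - int q) \<longleftrightarrow>
      symb_degree b = m \<and> (\<forall>i. Poly_Mapping.lookup \<alpha> i + q = ?e i + p)"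
  proof -
    have "int a - (if P then 1 else 0) - int p = int c - int q \<longleftrightarrow> a + q = c + (if P then 1 else 0) + p"
      for a c P by auto
    then show ?thesis by (simp add: b mdeg_def symb_degree_def fun_eq_iff)
  qed
  also have "\<dots> \<longleftrightarrow> symb_degree b = m \<and> \<alpha> = exponent b \<and> (\<forall>i. q \<le> ?e i + p)"
  proof -
    have "a + q = c \<longleftrightarrow> a = c - q \<and> q \<le> c" for a c :: nat by auto
    then show ?thesis by (auto simp: poly_mapping_eq_iff fun_eq_iff lookup_exponent b)
  qed
  finally have mdeg: "mdeg b \<alpha> = (m, \<lambda>i. int (u i) - int q) \<longleftrightarrow>
     symb_degree b = m \<and> \<alpha> = exponent b \<and> (\<forall>i. q \<le> ?e i + p)" .
  have zero: "Poly_Mapping.lookup (exponent b) i = 0 \<longleftrightarrow> ?e i + p \<le> q" for i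
    by (simp add: lookup_exponent b)
  have "(\<exists>i. Poly_Mapping.lookup \<alpha> i = 0) \<and> mdeg b \<alpha> = (m, \<lambda>i. int (u i) - int q) \<longleftrightarrow>
     symb_degree b = m \<and> \<alpha> = exponent b \<and> (\<forall>i. q \<le> ?e i + p) \<and> (\<exists>i. ?e i + p \<le> q)"
    unfolding mdeg zero[symmetric] by blast
  moreover have "(\<forall>i. q \<le> ?e i + p) \<and> (\<exists>i. ?e i + p \<le> q) \<longleftrightarrow>
      (if Z \<subseteq> I then Suc p = q else p = q)" (is "?L \<longleftrightarrow> ?R")
  proof (cases "Z \<subseteq> I")
    case True
    have 1: "1 \<le> ?e i" for i using True by (cases "u i = 0") (auto simp: Z_def)
    have 2: "?e j0 = 1" using True j0 j0_in_Z by auto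
    show ?thesis
    proof
      assume L: ?L
      then obtain i where "?e i + p \<le> q" by blast
      moreover have "q \<le> ?e j0 + p" using L by blast
      ultimately show ?R using True 1[of i] 2 by simp
    next
      assume ?R
      then have "q = Suc p" using True by simp
      then show ?L using 1 2 by (metis add_le_mono1 plus_1_eq_Suc order_refl)
    qed
  next
    case False
    then obtain k where k: "u k = 0" "k \<notin> I" by (auto simp: Z_def)
    show ?thesis
    proof
      assume L: ?L
      then obtain i where "?e i + p \<le> q" by blast
      moreover have "q \<le> ?e k + p" using L by blast
      ultimately show ?R using False k by simp
    next
      assume ?R
      then have "q = p" using False by simp
      then show ?L using k by (auto intro!: exI[of _ k])
    qed
  qed
  ultimately show ?thesis unfolding b fst_conv snd_conv by blast
qed

lemma graded_cochains_fibre: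
  "graded_cochains (m, \<lambda>i. int (u i) - int q) = cochain_vs.span
     (std ` {b. symb_degree b = m \<and> (if Z \<subseteq> fst b then Suc (snd b) = q else snd b = q)})"
  unfolding graded_cochains_def mdeg_fibre std_def
  by (rule arg_cong[where f = cochain_vs.span]) blast

lemma exponent_has_zero:
  assumes "if Z \<subseteq> fst b then Suc (snd b) = q else snd b = q"
  shows "0 \<in> range (Poly_Mapping.lookup (exponent b))"
proof -
  have "\<exists>i. Poly_Mapping.lookup (exponent b) i = 0"
    by (rule mdeg_fibre[of _ b "symb_degree b", THEN iffD2, THEN conjunct1]) (intro conjI refl assms)
  then show ?thesis by (metis rangeI)
qed

lemma coord_coeff_std:
  assumes "if Z \<subseteq> fst b then Suc (snd b) = q else snd b = q"
  shows "coord_coeff (exponent b) (std b' (res_basis b)) = (if b' = b then 1 else 0)"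
  using exponent_has_zero[OF assms] by (simp add: std_def std_cochain_basis coord_coeff_monom)

text \<open>By \<open>coord_coeff_std\<close> the coefficient functionals are dual to the standard
  elements of the fibre, so they recover the coordinates; linearity extends this to the
  span.\<close>

lemma graded_cochain_expand:
  fixes f :: "('n, 'k::field) resolution \<Rightarrow> ('n, 'k) coord_ring"
  assumes "f \<in> graded_cochains (m, \<lambda>i. int (u i) - int q)"
  shows "f = (\<Sum>b | symb_degree b = m \<and> (if Z \<subseteq> fst b then Suc (snd b) = q else snd b = q).
     cochain_scale (coord_coeff (exponent b) (f (res_basis b))) (std b))"
proof -
  let ?S = "{b. symb_degree b = m \<and> (if Z \<subseteq> fst b then Suc (snd b) = q else snd b = q)}"
  have fin: "finite ?S"
    by (rule finite_subset[of _ "UNIV \<times> {..q}"]) (auto split: if_splits)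
  show ?thesis
    using assms unfolding graded_cochains_fibre
  proof (induction rule: cochain_vs.span_induct_alt)
    case base
    then show ?case by simp
  next
    case (step c x y)
    then obtain b where b: "b \<in> ?S" "x = std b" by blast
    have "(\<Sum>b'\<in>?S. cochain_scale (coord_coeff (exponent b') (x (res_basis b'))) (std b' :: ('n, 'k) resolution \<Rightarrow> _))
        = (\<Sum>b'\<in>?S. if b' = b then std b' else 0)"
      by (rule sum.cong) (auto simp: b coord_coeff_std)
    also have "\<dots> = x" using fin b by simp
    finally have x: "x = (\<Sum>b'\<in>?S. cochain_scale (coord_coeff (exponent b') (x (res_basis b'))) (std b'))" ..
    have "cochain_scale c x + y
      = cochain_scale c (\<Sum>b'\<in>?S. cochain_scale (coord_coeff (exponent b') (x (res_basis b'))) (std b'))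
        + (\<Sum>b'\<in>?S. cochain_scale (coord_coeff (exponent b') (y (res_basis b'))) (std b'))"
      by (rule arg_cong2[where f = "\<lambda>a b. cochain_scale c a + b", OF x step(2)])
    also have "\<dots> = (\<Sum>b'\<in>?S. cochain_scale
        (coord_coeff (exponent b') ((cochain_scale c x + y) (res_basis b'))) (std b'))"
      by (simp add: cochain_vs.scale_sum_right cochain_vs.scale_left_distrib coord_coeff_add
          coord_coeff_scale cochain_scale_def[of c x] flip: sum.distrib)
    finally show ?case .
  qed
qed

section \<open>Cocycles and relations within one multidegree\<close>

lemma coeff_coboundary:
  assumes f: "module_hom res_scale env_act f" and I: "\<not> Z \<subseteq> I"
  shows "coord_coeff (exponent (I, q)) (f (res_diff_basis (I, q))) = (if q = 0 then 0 else
    (\<Sum>j\<in>- I. if Z - I = {j} then (-1) ^ card {i\<in>I. i < j} *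
       coord_coeff (exponent (insert j I, q - 1)) (f (res_basis (insert j I, q - 1))) else 0))"
proof (cases q)
  case (Suc p)
  then have q: "Suc p = q" "q - Suc 0 = p" "q \<noteq> 0" by simp_all
  have zero: "0 \<in> range (Poly_Mapping.lookup (exponent (I, q)))"
    using exponent_has_zero[of "(I, q)"] I by simp
  have "coord_coeff (exponent (I, q)) (f (res_diff_basis (I, q))) =
    (\<Sum>j\<in>- I. (-1) ^ card {i\<in>I. i < j} * coord_coeff (exponent (I, q))
       (coord_monom (cofactor j) * f (res_basis (insert j I, p))))"
    by (simp add: hom_res_diff_basis[OF f] coord_coeff_sum coord_coeff_scale q)
  also have "\<dots> = (\<Sum>j\<in>- I. if Z - I = {j} then (-1) ^ card {i\<in>I. i < j} *
       coord_coeff (exponent (insert j I, p)) (f (res_basis (insert j I, p))) else 0)"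
  proof (rule sum.cong[OF refl])
    fix j assume j: "j \<in> - I"
    \<comment> \<open>The exponent of \<open>(I, q)\<close> vanishes exactly on
      \<open>Z - I\<close>, so divisibility by the cofactor leaves at most \<open>j\<close>
      there.\<close>
    have "(\<forall>i. Poly_Mapping.lookup (cofactor j) i \<le> Poly_Mapping.lookup (exponent (I, q)) i)
        \<longleftrightarrow> Z - I \<subseteq> {j}"
      by (auto simp: lookup_cofactor lookup_exponent Z_def Suc_le_eq)
    also have "\<dots> \<longleftrightarrow> Z - I = {j}" using I by auto
    finally have 1: "(\<forall>i. Poly_Mapping.lookup (cofactor j) i \<le> Poly_Mapping.lookup (exponent (I, q)) i)
        \<longleftrightarrow> Z - I = {j}" .
    \<comment> \<open>Lowering every exponent except that of \<open>j\<close> by one amounts to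
      replacing \<open>q\<close> by \<open>p\<close> and adding \<open>j\<close> to
      \<open>I\<close>.\<close>
    have 2: "exponent (I, q) - cofactor j = exponent (insert j I, p)"
      using j by (intro poly_mapping_eqI) (use q in \<open>auto simp: lookup_minus lookup_cofactor lookup_exponent\<close>)
    show "(-1) ^ card {i\<in>I. i < j} * coord_coeff (exponent (I, q))
       (coord_monom (cofactor j) * f (res_basis (insert j I, p)))
      = (if Z - I = {j} then (-1) ^ card {i\<in>I. i < j} *
       coord_coeff (exponent (insert j I, p)) (f (res_basis (insert j I, p))) else 0)"
      unfolding coord_coeff_monom_mult[OF zero] 1 2 by simp
  qed
  finally show ?thesis by (simp add: q(2,3) cong: if_cong)
qed (simp add: hom_res_diff_basis[OF f])

lemma coeff_coboundary_single:
  assumes f: "module_hom res_scale env_act f" and I: "Z - I = {j}" and q: "Suc p = q"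
  shows "coord_coeff (exponent (I, q)) (f (res_diff_basis (I, q))) = (-1) ^ card {i\<in>I. i < j} *
       coord_coeff (exponent (insert j I, p)) (f (res_basis (insert j I, p)))"
proof -
  have "\<not> Z \<subseteq> I" "j \<notin> I" "q - Suc 0 = p" "q \<noteq> 0" using I q by auto
  then show ?thesis
    by (simp add: coeff_coboundary[OF f] I eq_commute[of j])
qed

lemma coeff_coboundary_zero:
  assumes f: "module_hom res_scale env_act f" and I: "\<not> Z \<subseteq> I" and "q = 0 \<or> (\<forall>j. Z - I \<noteq> {j})"
  shows "coord_coeff (exponent (I, q)) (f (res_diff_basis (I, q))) = 0"
  using assms by (auto simp: coeff_coboundary[OF f I])

text \<open>Each term of the coboundary removes some \<open>j \<in> I\<close>, where the exponent is
  already positive; the cofactor makes all other exponents positive, so the monomial vanishes in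
  A.\<close>

lemma std_cocycle:
  assumes "\<not> Z \<subseteq> I"
  shows "std (I, q) \<in> (cocycles :: (('n, 'k::field) resolution \<Rightarrow> ('n, 'k) coord_ring) set)"
proof -
  have "(std_cochain (I - {j}, Suc q) (exponent (I, q) + cofactor j)
      :: ('n, 'k) resolution \<Rightarrow> ('n, 'k) coord_ring) = 0" if "j \<in> I" for j
  proof -
    have "(coord_monom (exponent (I, q) + cofactor j) :: ('n, 'k) coord_ring) = 0"
      using that by (intro coord_monom_eq_0) (simp add: lookup_add lookup_cofactor lookup_exponent)
    then show ?thesis by (simp add: std_cochain_def fun_eq_iff)
  qed
  then show ?thesis
    by (simp add: cocycles_def std_def std_cochain_cochains coboundary_std_cochain)
qed

text \<open>For \<open>j\<close> in \<open>J - Z\<close> the exponent at \<open>j\<close> is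
  \<open>u j > 0\<close>, so multiplication by the cofactor kills the monomial; only
  \<open>j \<in> Z\<close> survives.\<close>

lemma coboundary_std:
  fixes J :: "'n set"
  assumes J: "Z \<subseteq> J" and q: "Suc p = q"
  shows "coboundary (std (J, p) :: ('n, 'k::field) resolution \<Rightarrow> ('n, 'k) coord_ring)
    = (\<Sum>j\<in>Z. cochain_scale ((-1) ^ card {i\<in>J. i < j}) (std (J - {j}, q)))"
  unfolding std_def coboundary_std_cochain
proof (rule sum.mono_neutral_cong_right[OF finite J])
  show "\<forall>j\<in>J - Z. cochain_scale ((-1) ^ card {i\<in>J. i < j}) (std_cochain (J - {j}, Suc p)
    (exponent (J, p) + cofactor j)) = (0 :: ('n, 'k) resolution \<Rightarrow> ('n, 'k) coord_ring)"
  proof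
    fix j assume j: "j \<in> J - Z"
    have "(coord_monom (exponent (J, p) + cofactor j) :: ('n, 'k) coord_ring) = 0"
      using j by (intro coord_monom_eq_0) (use q in \<open>simp add: lookup_add lookup_cofactor lookup_exponent Z_def\<close>)
    then show "cochain_scale ((-1) ^ card {i\<in>J. i < j}) (std_cochain (J - {j}, Suc p)
      (exponent (J, p) + cofactor j)) = (0 :: ('n, 'k) resolution \<Rightarrow> ('n, 'k) coord_ring)"
      by (simp add: std_cochain_def fun_eq_iff cochain_scale_def)
  qed
  fix j assume j: "j \<in> Z"
  \<comment> \<open>No truncation occurs: \<open>u k = 0\<close> puts \<open>k\<close> in
    \<open>Z\<close>, hence in \<open>J\<close>, which compensates for
    \<open>p = q - 1\<close>.\<close>
  have "Poly_Mapping.lookup (exponent (J, p) + cofactor j) k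
      = Poly_Mapping.lookup (exponent (J - {j}, q)) k" for k
    using J j q by (cases "u k = 0"; cases "k = j")
      (auto simp: lookup_add lookup_cofactor lookup_exponent Z_def)
  then have "exponent (J, p) + cofactor j = exponent (J - {j}, q)"
    by (rule poly_mapping_eqI)
  then show "cochain_scale ((-1) ^ card {i\<in>J. i < j}) (std_cochain (J - {j}, Suc p)
    (exponent (J, p) + cofactor j)) = cochain_scale ((-1) ^ card {i\<in>J. i < j})
    (std_cochain (J - {j}, q) (exponent (J - {j}, q)))"
    by (simp add: q)
qed

text \<open>Compare coefficients with a coboundary. If \<open>q = 0\<close> or \<open>Z - I\<close>
  is not a singleton, its coefficient at \<open>I\<close> is 0. If \<open>Z - I = {j}\<close>, that
  coefficient is up to sign the coordinate of \<open>f\<close> at \<open>insert j I\<close>, which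
  also governs the coefficient at \<open>insert j I - {j0}\<close>.\<close>

lemma coboundary_independent:
  fixes c :: "'n set \<Rightarrow> 'k::field"
  assumes "(\<Sum>I | card I + 2 * q = m \<and> \<not> W \<subseteq> I. cochain_scale (c I) (std (I, q))) \<in> coboundaries"
    and I: "card I + 2 * q = m" "\<not> W \<subseteq> I"
  shows "c I = 0"
proof -
  let ?B = "{I. card I + 2 * q = m \<and> \<not> W \<subseteq> I}"
  obtain f :: "('n, 'k) resolution \<Rightarrow> ('n, 'k) coord_ring" where f: "f \<in> cochains"
      "coboundary f = (\<Sum>I\<in>?B. cochain_scale (c I) (std (I, q)))"
    using assms(1)[unfolded coboundaries_def] by (rule imageE) (rule that, assumption, rule sym)
  have hom: "module_hom res_scale env_act f" using f(1) by (simp add: cochains_def)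
  have coeff: "coord_coeff (exponent (I, q)) (f (res_diff_basis (I, q))) = (if I \<in> ?B then c I else 0)"
    if "\<not> Z \<subseteq> I" for I
  proof -
    have "coord_coeff (exponent (I, q)) (f (res_diff_basis (I, q)))
       = (\<Sum>I'\<in>?B. c I' * coord_coeff (exponent (I, q)) (std (I', q) (res_basis (I, q))))"
      unfolding coboundary_basis[symmetric] f(2) sum_cochain_apply coord_coeff_sum coord_coeff_scale ..
    also have "\<dots> = (\<Sum>I'\<in>?B. if I' = I then c I' else 0)"
      using that by (intro sum.cong) (auto simp: coord_coeff_std)
    finally show ?thesis by simp
  qed
  have nZ: "\<not> Z \<subseteq> I" using I(2) by (auto simp: W_def split: if_splits)
  show ?thesis
  proof (cases "q = 0 \<or> (\<forall>j. Z - I \<noteq> {j})")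
    case True
    then show ?thesis
      using coeff_coboundary_zero[OF hom nZ] coeff[OF nZ] I by simp
  next
    case False
    then obtain j p where j: "Z - I = {j}" and q: "Suc p = q" by (metis not0_implies_Suc)
    then have "j \<noteq> j0" using I(2) by (auto simp: W_def split: if_splits)
    then have j0I: "j0 \<in> I" using j j0_in_Z by auto
    let ?J = "insert j I"
    have J: "Z - (?J - {j0}) = {j0}" using j j0_in_Z by auto
    then have nZJ: "\<not> Z \<subseteq> ?J - {j0}" by auto
    \<comment> \<open>This set contains \<open>W\<close>, so it is absent from the given combination
      and forces the coordinate of \<open>f\<close> at \<open>?J\<close> to vanish.\<close>
    moreover have "?J - {j0} \<notin> ?B" using J q by (auto simp: W_def)
    ultimately have "coord_coeff (exponent (?J - {j0}, q)) (f (res_diff_basis (?J - {j0}, q))) = 0"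
      using coeff[OF nZJ] by (simp only: if_False)
    moreover have "insert j0 (?J - {j0}) = ?J" using j0I by auto
    ultimately have "coord_coeff (exponent (?J, p)) (f (res_basis (?J, p))) = 0"
      using coeff_coboundary_single[OF hom J q] by simp
    then show ?thesis
      using coeff_coboundary_single[OF hom j q] coeff[OF nZ] I by simp
  qed
qed

text \<open>The coordinate at \<open>(J, p)\<close> with \<open>Z \<subseteq> J\<close> is up to
  sign the coefficient of the coboundary at \<open>(J - {j0}, q)\<close>, hence 0 for a
  cocycle.\<close>

lemma cocycle_expand:
  fixes f :: "('n, 'k::field) resolution \<Rightarrow> ('n, 'k) coord_ring"
  assumes f: "f \<in> cocycles" and graded: "f \<in> graded_cochains (m, \<lambda>i. int (u i) - int q)"
  shows "f = (\<Sum>I | card I + 2 * q = m \<and> \<not> Z \<subseteq> I.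
    cochain_scale (coord_coeff (exponent (I, q)) (f (res_basis (I, q)))) (std (I, q)))"
proof -
  let ?S = "{b. symb_degree b = m \<and> (if Z \<subseteq> fst b then Suc (snd b) = q else snd b = q)}"
  let ?B = "{I. card I + 2 * q = m \<and> \<not> Z \<subseteq> I}"
  let ?c = "\<lambda>b. coord_coeff (exponent b) (f (res_basis b))"
  have fin: "finite ?S"
    by (rule finite_subset[of _ "UNIV \<times> {..q}"]) (auto split: if_splits)
  have hom: "module_hom res_scale env_act f" using f by (simp add: cocycles_def cochains_def)
  have zero: "?c (J, p) = 0" if J: "Z \<subseteq> J" and q: "Suc p = q" for J p
  proof -
    have *: "Z - (J - {j0}) = {j0}" "insert j0 (J - {j0}) = J" using J j0_in_Z by auto
    have "f (res_diff_basis b) = 0" for b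
      using f coboundary_basis[of f b] by (simp add: cocycles_def)
    then show ?thesis using coeff_coboundary_single[OF hom *(1) q] *(2) by simp
  qed
  have "f = (\<Sum>b\<in>?S. cochain_scale (?c b) (std b))"
    by (rule graded_cochain_expand[OF graded])
  also have "\<dots> = (\<Sum>b\<in>(\<lambda>I. (I, q)) ` ?B. cochain_scale (?c b) (std b))"
  proof (rule sum.mono_neutral_right[OF fin])
    show "(\<lambda>I. (I, q)) ` ?B \<subseteq> ?S"
      by (auto simp: symb_degree_def)
    show "\<forall>b\<in>?S - (\<lambda>I. (I, q)) ` ?B. cochain_scale (?c b) (std b :: ('n, 'k) resolution \<Rightarrow> _) = 0"
    proof
      fix b assume b: "b \<in> ?S - (\<lambda>I. (I, q)) ` ?B"
      obtain J p where bJ: "b = (J, p)" by (cases b)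
      have "Z \<subseteq> J"
      proof (rule ccontr)
        assume "\<not> Z \<subseteq> J"
        with b have "p = q" "J \<in> ?B" by (auto simp: bJ symb_degree_def)
        with b show False by (simp add: bJ)
      qed
      moreover from this b have "Suc p = q" by (simp add: bJ)
      ultimately have "?c b = 0" unfolding bJ by (rule zero)
      then show "cochain_scale (?c b) (std b :: ('n, 'k) resolution \<Rightarrow> _) = 0"
        by (simp only: cochain_vs.scale_zero_left)
    qed
  qed
  also have "\<dots> = (\<Sum>I\<in>?B. cochain_scale (?c (I, q)) (std (I, q)))"
    by (subst sum.reindex) (auto simp: inj_on_def)
  finally show ?thesis .
qed

text \<open>The case to settle is \<open>Z - I = {j0}\<close>. The coboundary of the standard
  element at \<open>insert j0 I\<close> expresses the class of \<open>I\<close> through the sets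
  \<open>insert j0 I - {j}\<close> with \<open>j \<in> W\<close>, and these do not contain
  \<open>W\<close>.\<close>

lemma abs_HH_std_in_span:
  fixes B :: "('n, 'k::field) HH set"
  assumes B: "B = (\<lambda>I. abs_HH (std (I, q))) ` {I. card I + 2 * q = m \<and> \<not> W \<subseteq> I}"
    and I: "card I + 2 * q = m" "\<not> Z \<subseteq> I"
  shows "abs_HH (std (I, q)) \<in> HH_vs.span B"
proof (cases "W \<subseteq> I")
  case False
  then show ?thesis unfolding B by (intro HH_vs.span_base imageI) (simp add: I)
next
  case True
  with I have "q \<noteq> 0" by (auto simp: W_def)
  then obtain p where q: "Suc p = q" using not0_implies_Suc by metis
  with True have W: "W = Z - {j0}" "Z - {j0} \<subseteq> I" by (auto simp: W_def)
  let ?J = "insert j0 I"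
  let ?c = "\<lambda>j. (-1) ^ card {i\<in>?J. i < j} :: 'k"
  let ?s = "\<lambda>j. std (?J - {j}, q) :: ('n, 'k) resolution \<Rightarrow> ('n, 'k) coord_ring"
  have j0I: "j0 \<notin> I" and ZJ: "Z \<subseteq> ?J" using I W by auto
  have cyc: "\<forall>j\<in>Z. ?s j \<in> cocycles" by (intro ballI std_cocycle) auto
  note rel = abs_HH_sum[of Z ?s ?c, OF finite cyc]
  have "coboundary (std (?J, p)) \<in> (coboundaries :: (('n, 'k) resolution \<Rightarrow> _) set)"
    unfolding std_def by (rule coboundary_std_in_coboundaries)
  then have "abs_HH (\<Sum>j\<in>Z. cochain_scale (?c j) (?s j)) = 0"
    unfolding coboundary_std[OF ZJ q] by (rule abs_HH_eq_0[OF rel[THEN conjunct1], THEN iffD2])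
  then have "(\<Sum>j\<in>Z. HH_scale (?c j) (abs_HH (?s j))) = 0"
    unfolding rel[THEN conjunct2] .
  then have "HH_scale (?c j0) (abs_HH (?s j0)) = - (\<Sum>j\<in>Z - {j0}. HH_scale (?c j) (abs_HH (?s j)))"
    by (subst (asm) sum.remove[OF finite j0_in_Z]) (rule eq_neg_iff_add_eq_0[THEN iffD2])
  moreover have "abs_HH (?s j) \<in> HH_vs.span B" if j: "j \<in> Z - {j0}" for j
  proof -
    have "card (?J - {j}) = card I" using j ZJ j0I by (auto simp: card_Diff_singleton)
    moreover have "\<not> W \<subseteq> ?J - {j}" using j W by auto
    ultimately show ?thesis unfolding B using I by (intro HH_vs.span_base imageI) simp
  qed
  ultimately have "HH_scale (?c j0) (abs_HH (?s j0)) \<in> HH_vs.span B"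
    by (simp only: HH_vs.span_neg HH_vs.span_sum HH_vs.span_scale)
  \<comment> \<open>The sign squares to 1, so applying it again removes it.\<close>
  then have "HH_scale (?c j0) (HH_scale (?c j0) (abs_HH (?s j0))) \<in> HH_vs.span B"
    by (rule HH_vs.span_scale)
  moreover have "?J - {j0} = I" using j0I by auto
  ultimately show ?thesis by (simp flip: power_add mult_2)
qed

lemma HH_component_eq_span:
  "(HH_component (m, \<lambda>i. int (u i) - int q) :: ('n, 'k::field) HH set) =
     HH_vs.span ((\<lambda>I. abs_HH (std (I, q))) ` {I. card I + 2 * q = m \<and> \<not> W \<subseteq> I})"
  (is "?H = HH_vs.span ?B")
proof
  show "?H \<subseteq> HH_vs.span ?B"
  proof
    fix x assume "x \<in> ?H"
    then obtain f where f: "f \<in> cocycles" "f \<in> graded_cochains (m, \<lambda>i. int (u i) - int q)"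
      "x = abs_HH f" by (auto simp: HH_component_def)
    let ?c = "\<lambda>I. coord_coeff (exponent (I, q)) (f (res_basis (I, q)))"
    have "x = abs_HH (\<Sum>I | card I + 2 * q = m \<and> \<not> Z \<subseteq> I. cochain_scale (?c I) (std (I, q)))"
      unfolding f(3) using cocycle_expand[OF f(1,2)] by (rule arg_cong)
    also have "\<dots> = (\<Sum>I | card I + 2 * q = m \<and> \<not> Z \<subseteq> I. HH_scale (?c I) (abs_HH (std (I, q))))"
      using std_cocycle by (intro abs_HH_sum[THEN conjunct2]) auto
    also have "\<dots> \<in> HH_vs.span ?B"
      by (intro HH_vs.span_sum HH_vs.span_scale abs_HH_std_in_span[OF refl]) auto
    finally show "x \<in> HH_vs.span ?B" .
  qed
  show "HH_vs.span ?B \<subseteq> ?H"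
  proof (rule HH_vs.span_minimal[OF _ subspace_HH_component], rule image_subsetI)
    fix I assume I: "I \<in> {I. card I + 2 * q = m \<and> \<not> W \<subseteq> I}"
    then have nZ: "\<not> Z \<subseteq> I" by (auto simp: W_def split: if_splits)
    have "std (I, q) \<in> graded_cochains (m, \<lambda>i. int (u i) - int q)"
      unfolding graded_cochains_fibre using I nZ
      by (intro cochain_vs.span_base imageI) (simp add: symb_degree_def)
    with std_cocycle[OF nZ] show "abs_HH (std (I, q)) \<in> ?H"
      unfolding HH_component_def by blast
  qed
qed

lemma dim_HH_component:
  "HH_vs.dim (HH_component (m, \<lambda>i. int (u i) - int q) :: ('n, 'k::field) HH set) =
     card {I. card I + 2 * q = m \<and> \<not> W \<subseteq> I}"
  unfolding HH_component_eq_span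
proof (rule HH_vs.dim_span_image_eq_card)
  let ?B = "{I. card I + 2 * q = m \<and> \<not> W \<subseteq> I}"
  fix c :: "'n set \<Rightarrow> 'k"
  assume *: "(\<Sum>I\<in>?B. HH_scale (c I) (abs_HH (std (I, q)))) = 0"
  have "\<forall>I\<in>?B. std (I, q) \<in> (cocycles :: (('n, 'k) resolution \<Rightarrow> _) set)"
    by (intro ballI std_cocycle) (auto simp: W_def split: if_splits)
  note rel = abs_HH_sum[of ?B "\<lambda>I. std (I, q)" c, OF finite this]
  have "(\<Sum>I\<in>?B. cochain_scale (c I) (std (I, q)))
      \<in> (coboundaries :: (('n, 'k) resolution \<Rightarrow> _) set)"
    unfolding abs_HH_eq_0[OF rel[THEN conjunct1], symmetric] rel[THEN conjunct2] by (rule *)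
  then show "\<forall>I\<in>?B. c I = 0"
    using coboundary_independent by blast
qed simp

end

text \<open>An index with exponent 0 has a nonpositive coordinate in the multidegree, so there are
  no standard elements here.\<close>

lemma dim_HH_component_positive:
  assumes "\<And>i. 0 < v i"
  shows "HH_vs.dim (HH_component (m, v) :: ('n::{finite,linorder}, 'k::field) HH set) = 0"
proof -
  have none: "mdeg b \<alpha> \<noteq> (m, v)" if "Poly_Mapping.lookup \<alpha> i = 0" for b :: "'n symb" and \<alpha> i
    using assms[of i] that by (auto simp: mdeg_def split: prod.splits if_splits)
  then have "graded_cochains (m, v) = ({0} :: (('n, 'k) resolution \<Rightarrow> ('n, 'k) coord_ring) set)"
  proof -
    have "{std_cochain b \<alpha> | b \<alpha>. (\<exists>i. Poly_Mapping.lookup \<alpha> i = 0) \<and> mdeg b \<alpha> = (m, v)}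
        = ({} :: (('n, 'k) resolution \<Rightarrow> ('n, 'k) coord_ring) set)"
      using none by blast
    then show ?thesis by (simp only: graded_cochains_def cochain_vs.span_empty)
  qed
  then have "HH_component (m, v) = ({0} :: ('n, 'k) HH set)"
    using cochain_vs.subspace_0[OF subspace_cocycles]
    by (auto simp: HH_component_def zero_HH.abs_eq)
  then show ?thesis
    using HH_vs.dim_eq_card[of "{}" "{0} :: ('n, 'k) HH set"] by (simp add: HH_vs.independent_empty)
qed

section \<open>Coefficients of series\<close>

text \<open>Series are compared for one exponent vector \<open>v\<close> at a time, as ordinary
  power series in \<open>a_0\<close>.\<close>

definition coeff_at :: "('n::finite \<Rightarrow> int) \<Rightarrow> 'n mlaurent fps \<Rightarrow> int fps" where
  "coeff_at v F = Abs_fps (\<lambda>m. mlaurent_coeff (fps_nth F m) v)"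

lemma mlaurent_fps_eqI:
  assumes "\<And>v. coeff_at v F = coeff_at v G" shows "F = G"
proof (rule fps_ext)
  fix m
  have "mlaurent_coeff (fps_nth F m) v = mlaurent_coeff (fps_nth G m) v" for v
    using arg_cong[OF assms[of v], of "\<lambda>f. fps_nth f m"] by (simp add: coeff_at_def)
  then show "fps_nth F m = fps_nth G m"
    by (metis mlaurent_coeff_inject ext)
qed

lemma coeff_at_add: "coeff_at v (F + G) = coeff_at v F + coeff_at v G"
  by (rule fps_ext) (simp add: coeff_at_def coeff_add)

lemma coeff_at_diff: "coeff_at v (F - G) = coeff_at v F - coeff_at v G"
  by (rule fps_ext) (simp add: coeff_at_def coeff_diff)

lemma mlaurent_coeff_0: "mlaurent_coeff 0 v = 0"
  using coeff_diff[of 0 0 v] by simp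

lemma coeff_at_avar0: "coeff_at v (avar0 * F) = fps_X * coeff_at v F"
  by (rule fps_ext) (simp add: coeff_at_def avar0_def mlaurent_coeff_0)

lemma coeff_at_avar0_power: "coeff_at v ((avar0 + 1) ^ k * F) = (fps_X + 1) ^ k * coeff_at v F"
  by (induction k) (simp_all add: mult.assoc distrib_right coeff_at_add coeff_at_avar0)

lemma coeff_at_monom: "coeff_at v (fps_const (mlaurent_monom u) * F) = coeff_at (v - u) F"
  by (rule fps_ext) (simp add: coeff_at_def coeff_monom_mult)

lemma coeff_at_prod_avar: "coeff_at v ((\<Prod>i\<in>UNIV. avar i) * F) = coeff_at (\<lambda>i. v i - 1) F"
  unfolding prod_var coeff_at_monom by (simp add: fun_diff_def)

lemma coeff_at_avar: "coeff_at v (avar i * F) = coeff_at (v(i := v i - 1)) F"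
proof -
  have "v - (\<lambda>j. if j = i then 1 else 0) = v(i := v i - 1)" by auto
  then show ?thesis by (simp add: avar_def mlaurent_var_def coeff_at_monom)
qed

lemma coeff_at_1: "coeff_at v 1 = (if v = (\<lambda>_. 0) then 1 else 0)"
  by (rule fps_ext) (simp add: coeff_at_def coeff_one mlaurent_coeff_0)

text \<open>The hypothesis says that \<open>f\<close> does not involve \<open>a_i\<close>, so only
  one term of the convolution can be nonzero.\<close>

lemma mlaurent_coeff_geom_mult:
  assumes "\<And>u. u i \<noteq> 0 \<Longrightarrow> mlaurent_coeff f u = 0"
  shows "mlaurent_coeff (geom_series i * f) v = (if 0 \<le> v i then mlaurent_coeff f (v(i := 0)) else 0)"
  using assms
proof transfer
  fix i :: 'n and f :: "('n \<Rightarrow> int) \<Rightarrow> int" and v :: "'n \<Rightarrow> int"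
  assume f: "\<And>u. u i \<noteq> 0 \<Longrightarrow> f u = 0"
  let ?g = "\<lambda>v. if 0 \<le> v i \<and> (\<forall>j. j \<noteq> i \<longrightarrow> v j = 0) then 1 else 0 :: int"
  let ?u = "(\<lambda>j. if j = i then v i else 0)"
  have "conv ?g f v = (\<Sum>u\<in>{?u}. ?g u * f (v - u))"
  proof (rule conv_superset)
    fix u assume u: "?g u \<noteq> 0" "f (v - u) \<noteq> 0"
    have "\<forall>j. j \<noteq> i \<longrightarrow> u j = 0" using u(1) by (auto split: if_splits)
    moreover have "(v - u) i = 0" using u(2) f[of "v - u"] by blast
    ultimately show "u \<in> {?u}" by (auto simp: fun_eq_iff)
  qed simp
  moreover have "v - ?u = v(i := 0)" by auto
  ultimately show "conv ?g f v = (if 0 \<le> v i then f (v(i := 0)) else 0)" by simp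
qed

lemma coeff_at_geom:
  assumes "\<And>u. u i \<noteq> 0 \<Longrightarrow> coeff_at u F = 0"
  shows "coeff_at v (inv_one_minus_var i * F) = (if 0 \<le> v i then coeff_at (v(i := 0)) F else 0)"
proof (rule fps_ext)
  fix m
  have "mlaurent_coeff (fps_nth F m) u = 0" if "u i \<noteq> 0" for u
    using arg_cong[OF assms[of u, OF that], of "\<lambda>f. fps_nth f m"] by (simp add: coeff_at_def)
  then show "fps_nth (coeff_at v (inv_one_minus_var i * F)) m
      = fps_nth (if 0 \<le> v i then coeff_at (v(i := 0)) F else 0) m"
    by (simp add: coeff_at_def inv_one_minus_var_def mlaurent_coeff_geom_mult)
qed

text \<open>(r + (s - r) a_i) / (1 - a_i) = r + s (a_i + a_i^2 + ...), so each variable contributes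
  \<open>r\<close> at exponent 0 and \<open>s\<close> at positive exponents. The assumptions say
  that \<open>r\<close> and \<open>s\<close> act like series in \<open>a_0\<close> alone.\<close>

lemma coeff_at_prod_factors:
  fixes r s :: "'n::finite mlaurent fps" and r' s' :: "int fps"
  assumes r: "\<And>v F. coeff_at v (r * F) = r' * coeff_at v F"
    and s: "\<And>v F. coeff_at v (s * F) = s' * coeff_at v F"
  shows "coeff_at v (\<Prod>i\<in>UNIV. (r + (s - r) * avar i) * inv_one_minus_var i)
    = (\<Prod>i\<in>UNIV. if v i < 0 then 0 else if v i = 0 then r' else s')"
proof -
  let ?P = "\<lambda>S. \<Prod>i\<in>S. (r + (s - r) * avar i) * inv_one_minus_var i"
  let ?g = "\<lambda>x::int. if x < 0 then 0 else if x = 0 then r' else s'"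
  \<comment> \<open>Partial products involve only the variables in \<open>S\<close>; this is what
    makes \<open>coeff_at_geom\<close> applicable to the next one.\<close>
  have "coeff_at v (?P S) = (if \<forall>i. i \<notin> S \<longrightarrow> v i = 0 then \<Prod>i\<in>S. ?g (v i) else 0)"
    if "finite S" for S v
    using that
  proof (induction S arbitrary: v)
    case empty
    then show ?case by (simp add: coeff_at_1 fun_eq_iff)
  next
    case (insert i S)
    let ?Q = "inv_one_minus_var i * ?P S"
    have Q: "coeff_at w ?Q = (if 0 \<le> w i then coeff_at (w(i := 0)) (?P S) else 0)" for w
      by (rule coeff_at_geom) (use insert in auto)
    have "?P (insert i S) = r * ?Q + s * (avar i * ?Q) - r * (avar i * ?Q)"
      using insert.hyps by (simp add: algebra_simps)
    then have "coeff_at v (?P (insert i S))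
        = r' * coeff_at v ?Q + s' * coeff_at (v(i := v i - 1)) ?Q - r' * coeff_at (v(i := v i - 1)) ?Q"
      by (simp only: coeff_at_add coeff_at_diff r s coeff_at_avar)
    also have "\<dots> = ?g (v i) * coeff_at (v(i := 0)) (?P S)"
      by (simp add: Q)
    also have "coeff_at (v(i := 0)) (?P S) = (if \<forall>j. j \<notin> insert i S \<longrightarrow> v j = 0 then \<Prod>j\<in>S. ?g (v j) else 0)"
    proof -
      have "(\<Prod>j\<in>S. ?g ((v(i := 0)) j)) = (\<Prod>j\<in>S. ?g (v j))"
        using insert.hyps by (intro prod.cong) auto
      moreover have "(\<forall>j. j \<notin> S \<longrightarrow> (v(i := 0)) j = 0) \<longleftrightarrow> (\<forall>j. j \<notin> insert i S \<longrightarrow> v j = 0)" by auto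
      ultimately show ?thesis unfolding insert.IH by (simp only:)
    qed
    also have "?g (v i) * \<dots> = (if \<forall>j. j \<notin> insert i S \<longrightarrow> v j = 0 then \<Prod>j\<in>insert i S. ?g (v j) else 0)"
      unfolding prod.insert[OF insert.hyps] by (simp only: mult_zero_right split: if_split) blast
    finally show ?case .
  qed
  from this[of UNIV v] show ?thesis by simp
qed

lemma coeff_at_prod_inv:
  "coeff_at v (\<Prod>i\<in>UNIV. inv_one_minus_var i :: 'n::finite mlaurent fps)
    = (if \<forall>i. 0 \<le> v i then 1 else 0)"
proof -
  have "(\<Prod>i\<in>UNIV. if v i < 0 then 0 else if v i = 0 then 1 else 1 :: int fps) = (if \<forall>i. 0 \<le> v i then 1 else 0)"
  proof (cases "\<forall>i. 0 \<le> v i")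
    case True
    then show ?thesis by (auto intro!: prod.neutral simp: not_less)
  next
    case False
    then obtain i where "v i < 0" by (auto simp: not_le)
    then have "(\<Prod>i\<in>UNIV. if v i < 0 then 0 else if v i = 0 then 1 else 1 :: int fps) = 0"
      by (intro prod_zero bexI[of _ i]) simp_all
    then show ?thesis by (simp only: False if_False)
  qed
  then show ?thesis
    using coeff_at_prod_factors[of 1 1 1 1 v] by simp
qed

text \<open>The preceding product formula with \<open>r = a_0\<close> and
  \<open>s = a_0 + 1\<close>.\<close>

lemma coeff_at_prod_avar0_plus:
  "coeff_at v ((\<Prod>i\<in>UNIV. avar0 + avar i) * (\<Prod>i\<in>UNIV. inv_one_minus_var i) :: 'n::finite mlaurent fps)
    = (if \<forall>i. 0 \<le> v i then fps_X ^ card {i. v i = 0} * (fps_X + 1) ^ (CARD('n) - card {i. v i = 0}) else 0)"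
proof -
  have "coeff_at v (\<Prod>i\<in>UNIV. (avar0 + ((avar0 + 1) - avar0) * avar i) * inv_one_minus_var i :: 'n mlaurent fps)
    = (\<Prod>i\<in>UNIV. if v i < 0 then 0 else if v i = 0 then fps_X else fps_X + 1)"
    by (rule coeff_at_prod_factors) (simp_all add: coeff_at_avar0 coeff_at_add distrib_right)
  also have "\<dots> = (if \<forall>i. 0 \<le> v i then fps_X ^ card {i. v i = 0} * (fps_X + 1) ^ (CARD('n) - card {i. v i = 0}) else 0)"
  proof (cases "\<forall>i. 0 \<le> v i")
    case True
    then have "(\<Prod>i\<in>UNIV. if v i < 0 then 0 else if v i = 0 then fps_X else fps_X + 1 :: int fps)
      = (\<Prod>i\<in>UNIV. if v i = 0 then fps_X else fps_X + 1)"
      by (intro prod.cong) (auto simp: not_less[symmetric])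
    also have "\<dots> = fps_X ^ card {i. v i = 0} * (fps_X + 1) ^ (CARD('n) - card {i. v i = 0})"
      by (simp add: prod.If_cases Compl_eq_Diff_UNIV card_Diff_subset flip: Compl_eq)
    finally show ?thesis using True by simp
  next
    case False
    then obtain i where "v i < 0" by (auto simp: not_le)
    then have "(\<Prod>i\<in>UNIV. if v i < 0 then 0 else if v i = 0 then fps_X else fps_X + 1 :: int fps) = 0"
      by (intro prod_zero bexI[of _ i]) simp_all
    then show ?thesis by (simp only: False if_False)
  qed
  finally show ?thesis by (simp add: prod.distrib)
qed

section \<open>Generating functions of families of subsets\<close>

lemma sum_Pow_power:
  fixes x :: "'a::comm_semiring_1"
  assumes "finite A"
  shows "(\<Sum>B\<in>Pow A. x ^ card B) = (x + 1) ^ card A"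
  using prod_add[OF assms, of "\<lambda>_. x" "\<lambda>_. 1"] by simp

text \<open>Subtract the supersets of \<open>W\<close>, which correspond to the subsets of its
  complement.\<close>

lemma sum_not_superset_power:
  fixes W :: "'n::finite set" and x :: "'a::comm_ring_1"
  shows "(\<Sum>I | \<not> W \<subseteq> I. x ^ card I) = (x + 1) ^ CARD('n) - x ^ card W * (x + 1) ^ (CARD('n) - card W)"
proof -
  have "{I. W \<subseteq> I} = (\<union>) W ` Pow (- W)"
    by (auto simp: image_iff intro!: bexI[of _ "_ - W"])
  moreover have "inj_on ((\<union>) W) (Pow (- W))" by (auto simp: inj_on_def)
  ultimately have "(\<Sum>I | W \<subseteq> I. x ^ card I) = (\<Sum>J\<in>Pow (- W). x ^ card (W \<union> J))"
    by (simp add: sum.reindex)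
  also have "\<dots> = (\<Sum>J\<in>Pow (- W). x ^ card W * x ^ card J)"
    by (intro sum.cong refl, subst card_Un_disjoint) (auto simp: power_add)
  also have "\<dots> = x ^ card W * (x + 1) ^ (CARD('n) - card W)"
    by (simp add: sum_Pow_power Compl_eq_Diff_UNIV card_Diff_subset flip: sum_distrib_left)
  finally have 1: "(\<Sum>I | W \<subseteq> I. x ^ card I) = x ^ card W * (x + 1) ^ (CARD('n) - card W)" .
  have "(\<Sum>I\<in>Pow (UNIV :: 'n set). x ^ card I) = (\<Sum>I | \<not> W \<subseteq> I. x ^ card I) + (\<Sum>I | W \<subseteq> I. x ^ card I)"
    by (subst sum.union_disjoint[symmetric]) (auto simp: Un_def)
  then show ?thesis unfolding 1 sum_Pow_power[OF finite] by (simp add: algebra_simps)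
qed

lemma fps_of_card:
  fixes P :: "'n::finite set \<Rightarrow> bool"
  shows "Abs_fps (\<lambda>m. int (card {I. card I + 2 * q = m \<and> P I})) = fps_X ^ (2 * q) * (\<Sum>I | P I. fps_X ^ card I)"
proof (rule fps_ext)
  fix m
  have "fps_nth (fps_X ^ (2 * q) * (\<Sum>I | P I. fps_X ^ card I) :: int fps) m
      = (\<Sum>I | P I. if card I + 2 * q = m then 1 else 0)"
    by (simp add: sum_distrib_left fps_sum_nth fps_X_power_nth add.commute flip: power_add)
       (rule sum.cong; auto)
  also have "\<dots> = int (card {I. card I + 2 * q = m \<and> P I})"
    by (simp add: sum.If_cases Collect_conj_eq Int_commute)
  finally show "fps_nth (Abs_fps (\<lambda>m. int (card {I. card I + 2 * q = m \<and> P I}))) m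
      = fps_nth (fps_X ^ (2 * q) * (\<Sum>I | P I. fps_X ^ card I)) m" by simp
qed

section \<open>The Hilbert series\<close>

lemma coeff_at_hilbert_series:
  "coeff_at v (hilbert_series HH_scale
      (HH_component :: nat \<times> ('n \<Rightarrow> int) \<Rightarrow> ('n::{finite,linorder}, 'k::field) HH set))
    = Abs_fps (\<lambda>m. int (HH_vs.dim (HH_component (m, v) :: ('n, 'k) HH set)))"
  unfolding coeff_at_def by (simp only: coeff_hilbert_series_HH)

lemma coeff_at_hilbert_series_positive:
  assumes "\<And>i. 0 < v i"
  shows "coeff_at v (hilbert_series HH_scale
      (HH_component :: nat \<times> ('n \<Rightarrow> int) \<Rightarrow> ('n::{finite,linorder}, 'k::field) HH set)) = 0"
  unfolding coeff_at_hilbert_series dim_HH_component_positive[OF assms]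
  by (simp add: fps_zero_def)

text \<open>Here \<open>-q\<close> is the minimum of \<open>v\<close>, and \<open>k\<close> is the
  cardinality of \<open>W\<close>: the minimum is attained on \<open>Z\<close>, from which
  \<open>j0\<close> is removed when \<open>q > 0\<close>.\<close>

lemma coeff_at_hilbert_series_nonpositive:
  fixes v :: "'n::{finite,linorder} \<Rightarrow> int"
  assumes min: "\<And>i. - int q \<le> v i" and j0: "v j0 = - int q"
  defines "k \<equiv> card {i. v i = - int q} - (if q = 0 then 0 else 1)"
  shows "coeff_at v (hilbert_series HH_scale (HH_component :: nat \<times> ('n \<Rightarrow> int) \<Rightarrow> ('n, 'k::field) HH set))
    = fps_X ^ (2 * q) * ((fps_X + 1) ^ CARD('n) - fps_X ^ k * (fps_X + 1) ^ (CARD('n) - k))"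
proof -
  define u where "u i = nat (v i + int q)" for i
  interpret degree_fibre u q j0
    by standard (simp add: u_def j0)
  have int_u: "int (u i) = v i + int q" for i using min[of i] by (simp add: u_def)
  have v: "v = (\<lambda>i. int (u i) - int q)" by (simp add: int_u)
  have "Z = {i. v i = - int q}" unfolding Z_def by (simp add: v)
  then have k: "card W = k"
    using j0_in_Z by (simp add: W_def k_def)
  have "coeff_at v (hilbert_series HH_scale (HH_component :: _ \<Rightarrow> ('n, 'k) HH set))
      = Abs_fps (\<lambda>m. int (card {I. card I + 2 * q = m \<and> \<not> W \<subseteq> I}))"
    unfolding coeff_at_hilbert_series by (subst v) (simp only: dim_HH_component)
  then show ?thesis
    by (simp only: fps_of_card sum_not_superset_power k)
qed

lemma ex_minimum: "\<exists>j. \<forall>i. v j \<le> (v i :: int)" for v :: "'n::finite \<Rightarrow> int"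
proof -
  have "Min (range v) \<in> range v" by (intro Min_in) auto
  then obtain j where "v j = Min (range v)" by (metis imageE)
  then have "\<forall>i. v j \<le> v i" by simp
  then show ?thesis ..
qed

text \<open>Multiplying by a_1 ... a_n shifts \<open>v\<close> by 1, so each coefficient identity
  relates the Hilbert series at \<open>v\<close> and at \<open>v - 1\<close>. Its form depends on
  the minimum of \<open>v\<close>, which gives four cases.\<close>

lemma hilbert_series_mult_denominator:
  "hilbert_series HH_scale
      (HH_component :: nat \<times> ('n \<Rightarrow> int) \<Rightarrow> ('n::{finite,linorder}, 'k::field) HH set)
      * ((\<Prod>i\<in>UNIV. avar i) - avar0 ^ 2)
    = ((avar0 + 1) ^ (CARD('n) + 1) * (\<Prod>i\<in>UNIV. avar i)
        - (\<Prod>i\<in>UNIV. avar0 + avar i) * (avar0 + (\<Prod>i\<in>UNIV. avar i)))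
      * (\<Prod>i\<in>UNIV. inv_one_minus_var i)"
  (is "?H * (?p - _) = (?a * ?p - ?t * _) * ?G")
proof (rule mlaurent_fps_eqI)
  fix v :: "'n \<Rightarrow> int"
  let ?X = "fps_X :: int fps" and ?n = "CARD('n)"
  let ?w = "\<lambda>i. v i - 1"
  define T where "T v = (if \<forall>i. 0 \<le> v i
    then ?X ^ card {i. v i = 0} * (?X + 1) ^ (?n - card {i. v i = 0}) else 0)" for v :: "'n \<Rightarrow> int"
  have "?H * (?p - avar0 ^ 2) = ?p * ?H - avar0 * (avar0 * ?H)"
    by (simp add: algebra_simps power2_eq_square)
  then have L: "coeff_at v (?H * (?p - avar0 ^ 2)) = coeff_at ?w ?H - ?X ^ 2 * coeff_at v ?H"
    by (simp only: coeff_at_diff coeff_at_prod_avar coeff_at_avar0 power2_eq_square mult.assoc)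
  have "(?a * ?p - ?t * (avar0 + ?p)) * ?G = ?a * (?p * ?G) - (avar0 * (?t * ?G) + ?p * (?t * ?G))"
    by (simp add: algebra_simps)
  then have R: "coeff_at v ((?a * ?p - ?t * (avar0 + ?p)) * ?G)
      = (?X + 1) ^ (?n + 1) * (if \<forall>i. 0 \<le> ?w i then 1 else 0) - (?X * T v + T ?w)"
    by (simp only: coeff_at_diff coeff_at_add coeff_at_prod_avar coeff_at_avar0 coeff_at_avar0_power
        coeff_at_prod_inv coeff_at_prod_avar0_plus T_def)
  obtain j where j: "\<And>i. v j \<le> v i" using ex_minimum[of v] by blast
  have zpos: "card {i. v i = v j} \<noteq> 0" by (simp add: card_eq_0_iff) blast
  have zle: "card {i. v i = v j} \<le> ?n" by (rule card_mono) auto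
  \<comment> \<open>Compares \<open>Z\<close> with \<open>Z\<close> minus one element, for the case
    where the minimum passes from 0 at \<open>v\<close> to -1 at \<open>v - 1\<close>.\<close>
  have pow: "(?X + 1) * (?X + 1) ^ (?n - k) = (?X + 1) ^ (?n - (k - 1))" if "k \<noteq> 0" "k \<le> ?n" for k
    using that by (simp add: Suc_diff_le flip: power_Suc)
  consider "2 \<le> v j" | "v j = 1" | "v j = 0" | "v j < 0" by linarith
  then show "coeff_at v (?H * (?p - avar0 ^ 2)) = coeff_at v ((?a * ?p - ?t * (avar0 + ?p)) * ?G)"
  proof cases
    case 1
    then have ge: "2 \<le> v i" for i using j[of i] by simp
    then have 0: "coeff_at ?w ?H = 0" "coeff_at v ?H = 0"
      by (auto intro!: coeff_at_hilbert_series_positive less_le_trans[OF _ ge])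
    have "v i \<noteq> 0" "?w i \<noteq> 0" "0 \<le> v i" "0 \<le> ?w i" for i using ge[of i] by auto
    then have "T v = (?X + 1) ^ ?n" "T ?w = (?X + 1) ^ ?n" "\<forall>i. 0 \<le> ?w i"
      by (auto simp: T_def)
    then show ?thesis unfolding L R 0 by (simp add: algebra_simps)
  next
    case 2
    then have ge: "0 < v i" for i using j[of i] by simp
    have 0: "coeff_at v ?H = 0"
      using ge by (rule coeff_at_hilbert_series_positive)
    have "coeff_at ?w ?H = (?X + 1) ^ ?n - T ?w"
      using coeff_at_hilbert_series_nonpositive[of 0 ?w j, where 'k = 'k] ge 2 by (simp add: T_def)
    moreover have "v i \<noteq> 0" "0 \<le> v i" "0 \<le> ?w i" for i using ge[of i] by auto
    then have "T v = (?X + 1) ^ ?n" "\<forall>i. 0 \<le> ?w i" by (auto simp: T_def)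
    ultimately show ?thesis unfolding L R 0 by (simp add: algebra_simps)
  next
    case 3
    then have ge: "0 \<le> v i" for i using j[of i] by simp
    let ?z = "card {i. v i = 0}"
    have z: "?z \<noteq> 0" "?z \<le> ?n" using zpos zle 3 by simp_all
    have 1: "coeff_at v ?H = (?X + 1) ^ ?n - ?X ^ ?z * (?X + 1) ^ (?n - ?z)"
      using coeff_at_hilbert_series_nonpositive[of 0 v j, where 'k = 'k] ge 3 by simp
    have "- 1 < v i" for i using ge[of i] by simp
    \<comment> \<open>At \<open>v - 1\<close> the lemma applies with \<open>q = 1\<close>, whence
      \<open>?z - 1\<close> in place of \<open>?z\<close>.\<close>
    then have 2: "coeff_at ?w ?H = ?X ^ 2 * ((?X + 1) ^ ?n - ?X ^ (?z - 1) * (?X + 1) ^ (?n - (?z - 1)))"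
      using coeff_at_hilbert_series_nonpositive[of 1 ?w j, where 'k = 'k] ge 3 by simp
    have X: "?X ^ ?z = ?X * ?X ^ (?z - 1)" by (simp only: power_eq_if[of _ ?z] z(1) if_False)
    have neg: "\<not> (\<forall>i. 0 \<le> ?w i)" using 3 by (auto intro!: exI[of _ j])
    then have "T ?w = 0" unfolding T_def by (rule if_not_P)
    moreover have "T v = ?X ^ ?z * (?X + 1) ^ (?n - ?z)" using ge by (simp add: T_def)
    ultimately show ?thesis
      unfolding L R if_not_P[OF neg] 1 2 pow[OF z, symmetric] X by (simp add: algebra_simps power2_eq_square)
  next
    case 4
    define q where "q = nat (- v j)"
    have q: "q \<noteq> 0" "v j = - int q" using 4 by (simp_all add: q_def)
    have ge: "- int q \<le> v i" for i using j[of i] q by simp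
    have "- 1 - int q < v i" for i using ge[of i] by simp
    \<comment> \<open>For a negative minimum, \<open>v\<close> and \<open>v - 1\<close> have the
      same \<open>k\<close>, so raising \<open>q\<close> by one only adds the factor
      \<open>a_0^2\<close>; both sides of the goal are 0.\<close>
    then have 1: "coeff_at ?w ?H = ?X ^ 2 * coeff_at v ?H"
      using coeff_at_hilbert_series_nonpositive[of "Suc q" ?w j, where 'k = 'k]
        coeff_at_hilbert_series_nonpositive[of q v j, where 'k = 'k] ge q
      by (simp add: power2_eq_square mult.assoc)
    have neg: "\<not> (\<forall>i. 0 \<le> v i)" "\<not> (\<forall>i. 0 \<le> ?w i)"
      using 4 by (auto intro!: exI[of _ j] simp: not_le)
    show ?thesis unfolding L R T_def if_not_P[OF neg(1)] if_not_P[OF neg(2)] 1 by simp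
  qed
qed

theorem theorem6p1:
  shows "hilbert_series HH_scale
      (HH_component :: nat \<times> ('n \<Rightarrow> int) \<Rightarrow> ('n::{finite,linorder}, 'k::field) HH set)
    = ((avar0 + 1) ^ (CARD('n) + 1) * (\<Prod>i\<in>UNIV. avar i)
        - (\<Prod>i\<in>UNIV. avar0 + avar i) * (avar0 + (\<Prod>i\<in>UNIV. avar i)))
      * inv_prod_minus_square * (\<Prod>i\<in>UNIV. inv_one_minus_var i)"
  (is "?H = ?N * _ * ?G")
proof -
  let ?d = "(\<Prod>i\<in>UNIV. avar i) - avar0 ^ 2 :: 'n mlaurent fps"
  \<comment> \<open>The denominator is invertible in the ring of series, so inserting it with its
    inverse reduces the claim to the multiplied form.\<close>
  have "?H = ?H * (?d * inv_prod_minus_square)"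
    by (simp only: inv_prod_minus_square mult_1_right)
  also have "\<dots> = ?H * ?d * inv_prod_minus_square"
    by (simp only: mult.assoc)
  also have "\<dots> = ?N * ?G * inv_prod_minus_square"
    by (simp only: hilbert_series_mult_denominator)
  also have "\<dots> = ?N * inv_prod_minus_square * ?G"
    by (simp only: mult.assoc mult.commute[of ?G])
  finally show ?thesis .
qed

end
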